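(* Let $(\Omega,\mu,d)$ be a metric measure space satisfying the standing assumptions, and let $X$ be a rearrangement-invariant space on $\Omega$ such that the isoperimetric Hardy operator $\tilde Q_I$ is bounded on $\bar X$. Let $w$ be an isoperimetric weight on $\Omega$ and let $\alpha>0$. Then there exists a constant $C=C(w,X)$ such that $$\|f\|_X\le r\,C\,\big\||\nabla f|\big\|_X+r^{-\alpha}\|w^{\alpha}f\|_X\quad\text{for all } r>0,$$ for all bounded $f\in Lip(\Omega)$ such that $m(f)=0$ (that is, $0$ is a median of $f$) or $\int_\Omega f\,d\mu=0$, if $\mu(\Omega)<\infty$; respectively for all $f\in Lip_0(\Omega)$, if $\mu(\Omega)=\infty$.
   Context: Setting and standing assumptions. $(\Omega,\mu,d)$ is a connected metric space with a Borel measure $\mu$ such that $\mu(K)<\infty$ for every compact $K\subset\Omega$. $Lip(\Omega)$ is the set of real-valued Lipschitz functions on $\Omega$ and $Lip_0(\Omega)$ the set of those with compact support. For $f\in Lip(\Omega)$, $|\nabla f(x)|=\limsup_{d(x,y)\to0}\frac{|f(x)-f(y)|}{d(x,y)}$. For a Borel set $A\subset\Omega$, $\mu^+(A)=\liminf_{h\to0}\frac{\mu(A_h)-\mu(A)}{h}$, where $A_h=\{x\in\Omega:d(x,A)<h\}$. The isoperimetric profile is $I:[0,\mu(\Omega))\to\mathbb{R}_+$, $I(t)=\inf\{\mu^+(A):\mu(A)=t\}$. It is assumed throughout that $I$ is concave, continuous and $I(0)=0$; when $\mu(\Omega)<\infty$ it is also assumed that $I$ is symmetric around $\mu(\Omega)/2$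 (so $I$ is increasing on $(0,\mu(\Omega)/2)$ and decreasing on $(\mu(\Omega)/2,\mu(\Omega))$); when $\mu(\Omega)=\infty$ it is assumed that $I$ is increasing. It is understood that $I>0$ on $(0,\mu(\Omega))$; the (non-decreasing) quotient $t/I(t)$ is read as $0$ at $t=0$ and as its limit at $t=\infty$. Median (when $\mu(\Omega)<\infty$). A real number $m(f)$ is a median of an integrable $f$ if $\mu\{f\ge m(f)\}\ge\mu(\Omega)/2$ and $\mu\{f\le m(f)\}\ge\mu(\Omega)/2$. Isoperimetric weight. A locally integrable $w:\Omega\to\mathbb{R}_+$ with $w>0$ a.e. is an isoperimetric weight if there is a constant $C(w)>0$ such that $\frac{\min\{\mu(\{w\le r\}),\mu(\Omega)/2\}}{I(\min\{\mu(\{w\le r\}),\mu(\Omega)/2\})}\le C(w)r$ for all $r>0$. Rearrangement-invariant (r.i.) spaces. For measurable $u$ on $\Omega$, $\mu_u(t)=\mu\{|u|>t\}$ and $u_\mu^*(s)=\inf\{t\ge0:\mu_u(t)\le s\}$, $s\in[0,\mu(\Omega))$. An r.i. space $X=X(\Omega)$ is a Banach function space in the sense of Bennett–Sharpley (in particular with the Fatou property) such that $g\in X$ and $f_\mu^*=g_\mu^*$ imply $f\in X$ and $\|f\|_X=\|g\|_X$. The measure space is assumed resonant (Bennett–Sharpley): for all measurable a.e. finite $f,g$, $\int_0^{\mu(\Omega)}f_\mu^*g_\mu^*\,ds=\sup\int_\Omega|f\tilde g|\,d\mu$, the supremum over all $\tilde g$ equimeasurable with $g$. Then $X$ is represented by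 an r.i. space $\bar X$ on $(0,\mu(\Omega))$ with Lebesgue measure such that $\|f\|_X=\|f_\mu^*\|_{\bar X}$. Isoperimetric Hardy operator. If $\mu(\Omega)<\infty$, $\tilde Q_If(t)=\frac{I(t)}{t}\int_t^{\mu(\Omega)/2}f(s)\frac{ds}{I(s)}$ for $0<t<\mu(\Omega)/2$ and $\tilde Q_If(t)=0$ for $t\ge\mu(\Omega)/2$; if $\mu(\Omega)=\infty$, $\tilde Q_If(t)=\frac{I(t)}{t}\int_t^{\infty}f(s)\frac{ds}{I(s)}$. *)

theory Defs
  imports "HOL-Analysis.Analysis"
begin

definition metric_measure_space :: "'a::metric_space measure \<Rightarrow> bool" where
  "metric_measure_space M \<longleftrightarrow>
     connected (UNIV :: 'a set) \<and> sets M = sets borel \<and>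
     (\<forall>K. compact K \<longrightarrow> emeasure M K < \<infinity>)"

text \<open>The set of all \<open>x\<close> with \<open>d(x, A) < h\<close>, where \<open>d(x, {}) = \<infinity>\<close>.
  (The library function \<open>infdist\<close> has \<open>infdist x {} = 0\<close> and is therefore avoided.)\<close>

definition enlarge :: "'a::metric_space set \<Rightarrow> real \<Rightarrow> 'a set" where
  "enlarge A h = (\<Union>a\<in>A. ball a h)"

definition minkowski_content :: "'a::metric_space measure \<Rightarrow> 'a set \<Rightarrow> ennreal" where
  "minkowski_content M A =
     Liminf (at_right 0) (\<lambda>h. (emeasure M (enlarge A h) - emeasure M A) / ennreal h)"

definition profile_ennreal :: "'a::metric_space measure \<Rightarrow> real \<Rightarrow> ennreal" where
  "profile_ennreal M t =
     (INF A \<in> {A \<in> sets M. emeasure M A = ennreal t}. minkowski_content M A)"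

definition profile :: "'a::metric_space measure \<Rightarrow> real \<Rightarrow> real" where
  "profile M t = enn2real (profile_ennreal M t)"

definition profile_dom :: "'a measure \<Rightarrow> real set" where
  "profile_dom M = {t. 0 \<le> t \<and> ennreal t < emeasure M (space M)}"

text \<open>The first conjunct says that the profile is real-valued on \<open>[0, \<mu>(\<Omega>))\<close>, so that
  \<^const>\<open>profile\<close> loses no information there. Monotonicity on the two halves of
  \<open>(0, \<mu>(\<Omega>))\<close> in the finite case is a consequence of concavity and symmetry.\<close>

definition profile_conditions :: "'a::metric_space measure \<Rightarrow> bool" where
  "profile_conditions M \<longleftrightarrow>
     (\<forall>t\<in>profile_dom M. profile_ennreal M t < \<infinity>) \<and>
     concave_on (profile_dom M) (profile M) \<and>
     continuous_on (profile_dom M) (profile M) \<and>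
     profile M 0 = 0 \<and>
     (\<forall>t\<in>profile_dom M. 0 < t \<longrightarrow> 0 < profile M t) \<and>
     (if emeasure M (space M) < \<infinity>
      then \<forall>t. 0 < t \<and> t < measure M (space M) \<longrightarrow>
             profile M (measure M (space M) - t) = profile M t
      else mono_on (profile_dom M) (profile M))"

text \<open>The quotient \<open>t / I(t)\<close> on \<open>[0, \<infinity>]\<close>, with its conventions at the two end points.\<close>

definition profile_quotient :: "'a::metric_space measure \<Rightarrow> ennreal \<Rightarrow> ennreal" where
  "profile_quotient M t =
     (if t = 0 then 0
      else if t = \<infinity> then Lim at_top (\<lambda>s::real. ennreal (s / profile M s))
      else ennreal (enn2real t / profile M (enn2real t)))"

text \<open>Local integrability is integrability on compact sets. If \<open>\<mu>(\<Omega>) = \<infinity>\<close>, then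
  \<open>\<mu>(\<Omega>) / 2 = \<infinity>\<close> in \<^typ>\<open>ennreal\<close>, and the minimum is the first argument.\<close>

definition isoperimetric_weight :: "'a::metric_space measure \<Rightarrow> ('a \<Rightarrow> real) \<Rightarrow> bool" where
  "isoperimetric_weight M w \<longleftrightarrow>
     w \<in> borel_measurable M \<and>
     (\<forall>K. compact K \<longrightarrow> set_integrable M K w) \<and>
     (\<forall>x. 0 \<le> w x) \<and> (AE x in M. 0 < w x) \<and>
     (\<exists>C>0. \<forall>r>0.
        profile_quotient M (min (emeasure M {x \<in> space M. w x \<le> r}) (emeasure M (space M) / 2))
          \<le> ennreal (C * r))"

definition gradient_modulus :: "('a::metric_space \<Rightarrow> real) \<Rightarrow> 'a \<Rightarrow> real" where
  "gradient_modulus f x =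
     enn2real (Limsup (at x) (\<lambda>y. ennreal (\<bar>f x - f y\<bar> / dist x y)))"

definition lip :: "('a::metric_space \<Rightarrow> real) set" where
  "lip = {f. \<exists>L. L-lipschitz_on UNIV f}"

definition lip0 :: "('a::metric_space \<Rightarrow> real) set" where
  "lip0 = {f \<in> lip. compact (closure {x. f x \<noteq> 0})}"

definition is_median :: "'a measure \<Rightarrow> ('a \<Rightarrow> real) \<Rightarrow> real \<Rightarrow> bool" where
  "is_median M f m \<longleftrightarrow>
     integrable M f \<and>
     emeasure M (space M) / 2 \<le> emeasure M {x \<in> space M. m \<le> f x} \<and>
     emeasure M (space M) / 2 \<le> emeasure M {x \<in> space M. f x \<le> m}"

text \<open>Distribution functions, rearrangements and function norms are defined on
  \<open>[0, \<infinity>]\<close>-valued measurable functions, as in Bennett--Sharpley; a real-valued \<open>u\<close> enters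
  through its absolute value. The threshold \<open>t = \<infinity>\<close> does not change the infimum below.\<close>

definition distribution_fun :: "'a measure \<Rightarrow> ('a \<Rightarrow> ennreal) \<Rightarrow> ennreal \<Rightarrow> ennreal" where
  "distribution_fun M u t = emeasure M {x \<in> space M. t < u x}"

definition rearrangement :: "'a measure \<Rightarrow> ('a \<Rightarrow> ennreal) \<Rightarrow> real \<Rightarrow> ennreal" where
  "rearrangement M u s = Inf {t. distribution_fun M u t \<le> ennreal s}"

definition interval_measure_space :: "'a measure \<Rightarrow> real measure" where
  "interval_measure_space M =
     restrict_space lborel {t. 0 < t \<and> ennreal t < emeasure M (space M)}"

definition banach_function_norm :: "'a measure \<Rightarrow> (('a \<Rightarrow> ennreal) \<Rightarrow> ennreal) \<Rightarrow> bool" where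
  "banach_function_norm M \<rho> \<longleftrightarrow>
     (\<forall>f\<in>borel_measurable M. \<rho> f = 0 \<longleftrightarrow> (AE x in M. f x = 0)) \<and>
     (\<forall>f\<in>borel_measurable M. \<forall>a\<ge>0. \<rho> (\<lambda>x. ennreal a * f x) = ennreal a * \<rho> f) \<and>
     (\<forall>f\<in>borel_measurable M. \<forall>g\<in>borel_measurable M. \<rho> (\<lambda>x. f x + g x) \<le> \<rho> f + \<rho> g) \<and>
     (\<forall>f\<in>borel_measurable M. \<forall>g\<in>borel_measurable M.
        (AE x in M. g x \<le> f x) \<longrightarrow> \<rho> g \<le> \<rho> f) \<and>
     (\<forall>F f. (\<forall>n::nat. F n \<in> borel_measurable M) \<and> f \<in> borel_measurable M \<and>
        (AE x in M. incseq (\<lambda>n. F n x) \<and> f x = (SUP n. F n x)) \<longrightarrow>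
        \<rho> f = (SUP n. \<rho> (F n))) \<and>
     (\<forall>E\<in>sets M. emeasure M E < \<infinity> \<longrightarrow> \<rho> (indicator E) < \<infinity>) \<and>
     (\<forall>E\<in>sets M. emeasure M E < \<infinity> \<longrightarrow>
        (\<exists>C>0. \<forall>f\<in>borel_measurable M. (\<integral>\<^sup>+x\<in>E. f x \<partial>M) \<le> ennreal C * \<rho> f))"

definition ri_norm :: "'a measure \<Rightarrow> (('a \<Rightarrow> ennreal) \<Rightarrow> ennreal) \<Rightarrow> bool" where
  "ri_norm M \<rho> \<longleftrightarrow>
     banach_function_norm M \<rho> \<and>
     (\<forall>f\<in>borel_measurable M. \<forall>g\<in>borel_measurable M.
        \<rho> g < \<infinity> \<and> (\<forall>s\<in>profile_dom M. rearrangement M f s = rearrangement M g s) \<longrightarrow>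
        \<rho> f = \<rho> g)"

text \<open>The norm of the space \<open>X = {f. \<rho>(|f|) < \<infinity>}\<close>; it is \<open>\<infinity>\<close> off \<open>X\<close>.\<close>

definition norm_in :: "(('a \<Rightarrow> ennreal) \<Rightarrow> ennreal) \<Rightarrow> ('a \<Rightarrow> real) \<Rightarrow> ennreal" where
  "norm_in \<rho> f = \<rho> (\<lambda>x. ennreal \<bar>f x\<bar>)"

definition resonant :: "'a measure \<Rightarrow> bool" where
  "resonant M \<longleftrightarrow>
     (\<forall>f\<in>borel_measurable M. \<forall>g\<in>borel_measurable M.
        (AE x in M. f x < \<infinity>) \<and> (AE x in M. g x < \<infinity>) \<longrightarrow>
        (\<integral>\<^sup>+s. rearrangement M f s * rearrangement M g s \<partial>interval_measure_space M) =
        (SUP g' \<in> {g' \<in> borel_measurable M. (AE x in M. g' x < \<infinity>) \<and>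
                     distribution_fun M g' = distribution_fun M g}.
           \<integral>\<^sup>+x. f x * g' x \<partial>M))"

definition represents ::
  "'a measure \<Rightarrow> (('a \<Rightarrow> ennreal) \<Rightarrow> ennreal) \<Rightarrow> ((real \<Rightarrow> ennreal) \<Rightarrow> ennreal) \<Rightarrow> bool" where
  "represents M \<rho> \<sigma> \<longleftrightarrow>
     ri_norm (interval_measure_space M) \<sigma> \<and>
     (\<forall>f\<in>borel_measurable M. (AE x in M. f x < \<infinity>) \<longrightarrow> \<rho> f = \<sigma> (rearrangement M f))"

text \<open>If \<open>\<mu>(\<Omega>) = \<infinity>\<close>, then \<open>\<mu>(\<Omega>) / 2 = \<infinity>\<close> in \<^typ>\<open>ennreal\<close>, so one formula covers
  both cases.\<close>

definition hardy_range :: "'a measure \<Rightarrow> real \<Rightarrow> real set" where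
  "hardy_range M t = {s. t < s \<and> ennreal s < emeasure M (space M) / 2}"

definition isoperimetric_hardy ::
  "'a::metric_space measure \<Rightarrow> (real \<Rightarrow> real) \<Rightarrow> real \<Rightarrow> real" where
  "isoperimetric_hardy M f t =
     (if t \<in> hardy_range M 0
      then profile M t / t * (LINT s:hardy_range M t|lborel. f s / profile M s)
      else 0)"

text \<open>Convergence of the defining integrals is part of boundedness, because the library
  integral of a non-integrable function is \<open>0\<close>.\<close>

definition isoperimetric_hardy_bounded ::
  "'a::metric_space measure \<Rightarrow> ((real \<Rightarrow> ennreal) \<Rightarrow> ennreal) \<Rightarrow> bool" where
  "isoperimetric_hardy_bounded M \<sigma> \<longleftrightarrow>
     (\<exists>B\<ge>0. \<forall>f\<in>borel_measurable (interval_measure_space M). norm_in \<sigma> f < \<infinity> \<longrightarrow>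
        (\<forall>t\<in>hardy_range M 0. set_integrable lborel (hardy_range M t) (\<lambda>s. f s / profile M s)) \<and>
        norm_in \<sigma> (isoperimetric_hardy M f) \<le> ennreal B * norm_in \<sigma> f)"

end

theory Submission imports Defs begin

text \<open>
  Split \<open>f\<close> at \<open>W = {w \<le> r}\<close>: off \<open>W\<close> we have \<open>|f| \<le> r\<^sup>-\<^sup>\<alpha> w\<^sup>\<alpha> |f|\<close>, so it remains to bound
  \<open>f 1\<^sub>W\<close> by \<open>r C |\<nabla>f|\<close> in norm. Suppose \<open>\<mu>{f > 0} \<le> m \<le> \<mu>(\<Omega>)/2\<close>. Integrating the
  isoperimetric inequality over the levels between \<open>f\<^sup>*(t)\<close> and \<open>f\<^sup>*(t')\<close>, \<open>t' < t\<close>, gives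
  \<open>(f\<^sup>*(t') - f\<^sup>*(t)) I(t') \<le> \<integral> |\<nabla>f|\<close> over the slab \<open>f\<^sup>*(t) < f < f\<^sup>*(t')\<close>. Concatenating the
  rearrangements of \<open>|\<nabla>f|\<close> on the slabs of an equidistant grid of mesh \<open>\<delta>\<close> yields a function \<open>h\<close>
  whose norm is at most that of \<open>|\<nabla>f|\<close> and which satisfies
  \<open>f\<^sup>*(t + \<delta>) \<le> 2 \<integral>\<^sub>t h/I = 2 (t/I(t)) Q h(t)\<close>, where \<open>t/I(t) \<le> C(w) r\<close> for \<open>t < \<mu>(W)\<close>. Now
  \<open>\<delta> \<rightarrow> 0\<close> by right continuity of \<open>f\<^sup>*\<close> and the Fatou property. This discretization replaces the
  derivative of \<open>f\<^sup>*\<close> and the Hardy--Littlewood--Polya principle.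

  For functions of mean zero, subtract a median \<open>c\<close>: the case \<open>W = \<Omega>\<close> bounds \<open>\<integral> |f - c|\<close>, hence
  \<open>|c|\<close>, by the norm of the gradient, and the norm of \<open>1\<^sub>W\<close> is \<open>O(r)\<close> by the boundedness of \<open>Q\<close>.
\<close>

section \<open>Distribution functions and decreasing rearrangements\<close>

text \<open>Right continuity of the distribution function: \<open>{l < u}\<close> is the increasing
  union of the sets \<open>{l + 1/(n+1) < u}\<close>, and measures are continuous from below. For
  \<open>l = top\<close> the set is empty.\<close>

lemma emeasure_superlevel_at_right:
  assumes u: "u \<in> borel_measurable M"
    and le: "\<And>l'. l < l' \<Longrightarrow> emeasure M {x \<in> space M. l' < u x} \<le> c"
  shows "emeasure M {x \<in> space M. (l::ennreal) < u x} \<le> c"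
proof (cases "l = top")
  case True
  then show ?thesis by simp
next
  case False
  let ?A = "\<lambda>n::nat. {x \<in> space M. l + ennreal (1 / Suc n) < u x}"
  have "(\<lambda>n::nat. l + ennreal (1 / Suc n)) \<longlonglongrightarrow> l + ennreal 0"
    by (intro tendsto_intros tendsto_ennrealI LIMSEQ_Suc[OF lim_1_over_n])
  then have "\<exists>n::nat. l + ennreal (1 / Suc n) < y" if "l < y" for y
    using order_tendstoD(2)[of _ "l + ennreal 0" sequentially y] that eventually_happens by force
  then have "{x \<in> space M. l < u x} = (\<Union>n. ?A n)"
    by (auto intro: le_less_trans[rotated])
  also have "emeasure M \<dots> = (SUP n. emeasure M (?A n))"
  proof (intro SUP_emeasure_incseq[symmetric] incseq_SucI)
    fix n :: nat
    have "l + ennreal (1 / Suc (Suc n)) \<le> l + ennreal (1 / Suc n)"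
      by (intro add_left_mono ennreal_leI) (simp add: frac_le)
    then show "?A n \<subseteq> ?A (Suc n)"
      using le_less_trans by blast
  qed (use u in auto)
  also have "\<dots> \<le> c"
  proof (intro SUP_least le)
    fix n :: nat
    have "l + 0 < l + ennreal (1 / Suc n)"
      using False by (subst ennreal_add_left_cancel_less) (simp add: ennreal_less_iff)
    then show "l < l + ennreal (1 / Suc n)" by simp
  qed
  finally show ?thesis .
qed

text \<open>By right continuity of the distribution function the infimum defining the rearrangement
  is attained, so the two functions are generalized inverses of each other. Superlevel sets of
  rearrangements thereby become initial intervals.\<close>

lemma less_rearrangement_iff:
  assumes u: "u \<in> borel_measurable M"
  shows "l < rearrangement M u s \<longleftrightarrow> ennreal s < distribution_fun M u l"
proof
  have anti: "distribution_fun M u t' \<le> distribution_fun M u t" if "t \<le> t'" for t t'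
    unfolding distribution_fun_def using u that by (intro emeasure_mono) auto
  show "ennreal s < distribution_fun M u l" if "l < rearrangement M u s"
  proof (rule ccontr)
    assume "\<not> ?thesis"
    then have "rearrangement M u s \<le> l"
      unfolding rearrangement_def by (intro Inf_lower) auto
    with that show False by auto
  qed
  show "l < rearrangement M u s" if less: "ennreal s < distribution_fun M u l"
  proof (rule ccontr)
    assume "\<not> ?thesis"
    then have le: "rearrangement M u s \<le> l" by simp
    have "distribution_fun M u l' \<le> ennreal s" if "l < l'" for l'
    proof -
      obtain t where "distribution_fun M u t \<le> ennreal s" "t < l'"
        using le_less_trans[OF le \<open>l < l'\<close>] unfolding rearrangement_def Inf_less_iff by blast
      then show ?thesis using anti[of t l'] by (meson less_imp_le order_trans)
    qed
    then have "distribution_fun M u l \<le> ennreal s"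
      unfolding distribution_fun_def by (rule emeasure_superlevel_at_right[OF u])
    then show False using less leD by blast
  qed
qed

lemma rearrangement_antimono:
  assumes "s \<le> s'"
  shows "rearrangement M u s' \<le> rearrangement M u s"
  unfolding rearrangement_def
proof (rule Inf_superset_mono, safe)
  fix t assume "distribution_fun M u t \<le> ennreal s"
  also have "\<dots> \<le> ennreal s'" using assms by (rule ennreal_leI)
  finally show "distribution_fun M u t \<le> ennreal s'" .
qed

lemma borel_measurable_antimono_ennreal:
  fixes f :: "real \<Rightarrow> ennreal"
  assumes "antimono f"
  shows "f \<in> borel_measurable borel"
proof (rule borel_measurableI_greater)
  fix y
  have "is_interval {x. y < f x}"
    unfolding is_interval_1 using assms by (auto simp: antimono_def intro: less_le_trans)
  then show "{x \<in> space borel. y < f x} \<in> sets borel"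
    using real_interval_borel_measurable by simp
qed

lemma rearrangement_measurable [measurable]: "rearrangement M u \<in> borel_measurable borel"
  by (intro borel_measurable_antimono_ennreal antimonoI rearrangement_antimono)

lemma space_interval_measure_space:
  "space (interval_measure_space M) = {t. 0 < t \<and> ennreal t < emeasure M (space M)}"
  unfolding interval_measure_space_def by (simp add: space_restrict_space)

text \<open>Allowing \<open>c\<close> to range over [0, \<infinity>] avoids separate treatment of
  spaces of finite and of infinite measure.\<close>

lemma emeasure_initial_interval: "emeasure lborel {t::real. 0 < t \<and> ennreal t < c} = c"
proof (cases c)
  case (real r)
  then have "{t::real. 0 < t \<and> ennreal t < c} = {0<..<r}" by (auto simp: ennreal_less_iff)
  with real show ?thesis by simp
next
  case top
  then have *: "{t::real. 0 < t \<and> ennreal t < c} = {0<..}" by auto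
  have "ennreal (real n) \<le> emeasure lborel {0::real<..}" for n
    using emeasure_mono[of "{0<..<real n}" "{0<..}" lborel] by (auto simp: subset_eq)
  then have "emeasure lborel {0::real<..} = top"
    by (metis ennreal_of_nat_eq_real_of_nat ennreal_Ex_less_of_nat less_top not_le)
  with * top show ?thesis by simp
qed

lemma measurable_interval_measure_space:
  assumes "f \<in> borel_measurable borel"
  shows "f \<in> borel_measurable (interval_measure_space M)"
  unfolding interval_measure_space_def using assms by (auto intro!: measurable_restrict_space1)

lemma emeasure_interval_measure_space:
  assumes "A \<in> sets borel" "A \<subseteq> {t. 0 < t \<and> ennreal t < emeasure M (space M)}"
  shows "emeasure (interval_measure_space M) A = emeasure lborel A"
  unfolding interval_measure_space_def using assms by (subst emeasure_restrict_space) auto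

lemma emeasure_interval_space:
  "emeasure (interval_measure_space M) (space (interval_measure_space M)) = emeasure M (space M)"
  by (subst emeasure_interval_measure_space) (auto simp: space_interval_measure_space emeasure_initial_interval)

lemma distribution_fun_le_space: "distribution_fun M u l \<le> emeasure M (space M)"
  unfolding distribution_fun_def by (rule emeasure_space)

text \<open>Equimeasurability: the superlevel set at \<open>l\<close> is the initial interval of
  length \<open>distribution_fun M u l\<close>. The second measure \<open>M'\<close> allows
  \<open>u\<close> to live already on the interval space of \<open>M'\<close>, as in the next proof
  that uses this fact.\<close>

lemma distribution_fun_rearrangement:
  assumes u: "u \<in> borel_measurable M" and S: "emeasure M (space M) = emeasure M' (space M')"
  shows "distribution_fun (interval_measure_space M') (rearrangement M u) l = distribution_fun M u l"
proof -
  have "distribution_fun (interval_measure_space M') (rearrangement M u) l =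
    emeasure (interval_measure_space M') {s. 0 < s \<and> ennreal s < distribution_fun M u l}"
    unfolding distribution_fun_def[of "interval_measure_space M'"]
    using distribution_fun_le_space[of M u l] S
    by (intro arg_cong[where f="emeasure _"])
       (auto simp: space_interval_measure_space less_rearrangement_iff[OF u])
  also have "\<dots> = distribution_fun M u l"
    using distribution_fun_le_space[of M u l] S
    by (subst emeasure_interval_measure_space) (auto simp: emeasure_initial_interval)
  finally show ?thesis .
qed

text \<open>Smaller distribution functions have pointwise smaller rearrangements, so the
  rearrangement of \<open>h\<close> has norm at most \<open>\<rho> v\<close>. Rearrangement
  invariance then transfers this to \<open>h\<close> itself; it is stated only against functions of
  finite norm, hence the separate case \<open>\<rho> v = \<infinity>\<close>.\<close>

lemma ri_norm_le_of_distribution_le: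
  assumes rep: "represents M \<rho> \<sigma>"
    and h: "h \<in> borel_measurable (interval_measure_space M)"
    and v: "v \<in> borel_measurable M" "AE x in M. v x < \<infinity>"
    and le: "\<And>l. distribution_fun (interval_measure_space M) h l \<le> distribution_fun M v l"
  shows "\<sigma> h \<le> \<rho> v"
proof (cases "\<rho> v = \<infinity>")
  case False
  let ?N = "interval_measure_space M"
  have ri: "ri_norm ?N \<sigma>" and eq: "\<rho> v = \<sigma> (rearrangement M v)"
    using rep v unfolding represents_def by auto
  have mono: "\<And>f g. f \<in> borel_measurable ?N \<Longrightarrow> g \<in> borel_measurable ?N \<Longrightarrow> AE x in ?N. g x \<le> f x \<Longrightarrow> \<sigma> g \<le> \<sigma> f"
    using ri unfolding ri_norm_def banach_function_norm_def by blast
  have "rearrangement ?N h s \<le> rearrangement M v s" for s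
    unfolding rearrangement_def by (rule Inf_superset_mono) (use le order_trans in blast)
  then have le': "\<sigma> (rearrangement ?N h) \<le> \<rho> v"
    unfolding eq by (intro mono measurable_interval_measure_space) auto
  then have fin: "\<sigma> (rearrangement ?N h) < \<infinity>" using False le_less_trans less_top by (metis infinity_ennreal_def)
  have "distribution_fun ?N (rearrangement ?N h) l = distribution_fun ?N h l" for l
    using distribution_fun_rearrangement[OF h emeasure_interval_space[of M]] .
  then have "rearrangement ?N (rearrangement ?N h) s = rearrangement ?N h s" for s
    unfolding rearrangement_def by simp
  then have "\<sigma> h = \<sigma> (rearrangement ?N h)"
    using ri h fin unfolding ri_norm_def by (metis measurable_interval_measure_space rearrangement_measurable)
  with le' show ?thesis by simp
qed simp

section \<open>Slopes at a fixed scale and the gradient modulus\<close>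

text \<open>This is the quantity inside the limes superior that defines
  \<open>gradient_modulus\<close>, before the scale \<open>h\<close> shrinks to 0. At a point with
  no other point within distance \<open>h\<close> it is the empty supremum 0.\<close>

definition local_slope :: "('a::metric_space \<Rightarrow> real) \<Rightarrow> real \<Rightarrow> 'a \<Rightarrow> ennreal" where
  "local_slope f h x = (SUP y\<in>ball x h - {x}. ennreal (\<bar>f x - f y\<bar> / dist x y))"

lemma local_slope_mono: "h \<le> h' \<Longrightarrow> local_slope f h x \<le> local_slope f h' x"
  unfolding local_slope_def by (intro SUP_subset_mono) auto

lemma lipschitz_on_abs_diff_le:
  fixes f :: "'a::metric_space \<Rightarrow> real"
  assumes "L-lipschitz_on UNIV f"
  shows "\<bar>f x - f y\<bar> \<le> L * dist x y"
  using lipschitz_onD[OF assms, of x y] by (simp add: dist_real_def)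

lemma local_slope_le_lipschitz:
  assumes "L-lipschitz_on UNIV f"
  shows "local_slope f h x \<le> ennreal L"
  unfolding local_slope_def
  using lipschitz_on_abs_diff_le[OF assms, of x]
  by (intro SUP_least ennreal_leI) (auto simp: divide_le_eq)

lemma abs_diff_le_local_slope:
  assumes L: "L-lipschitz_on UNIV f" and y: "dist x y < h"
  shows "\<bar>f x - f y\<bar> \<le> h * enn2real (local_slope f h x)"
proof (cases "x = y")
  case True
  then show ?thesis using y by simp
next
  case False
  have "ennreal (\<bar>f x - f y\<bar> / dist x y) \<le> local_slope f h x"
    unfolding local_slope_def using y False by (intro SUP_upper) auto
  also have "local_slope f h x = ennreal (enn2real (local_slope f h x))"
    using local_slope_le_lipschitz[OF L] by (intro ennreal_enn2real[symmetric]) (metis ennreal_less_top le_less_trans)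
  finally have "\<bar>f x - f y\<bar> / dist x y \<le> enn2real (local_slope f h x)"
    by simp
  then have "\<bar>f x - f y\<bar> \<le> dist x y * enn2real (local_slope f h x)"
    using False by (simp add: divide_le_eq mult.commute)
  also have "\<dots> \<le> h * enn2real (local_slope f h x)"
    using y by (intro mult_right_mono) auto
  finally show ?thesis .
qed

text \<open>The Lipschitz bound keeps the limes superior finite, so its conversion to a real number
  loses nothing. Since slopes grow with the scale, the infimum over all scales is already reached
  along \<open>h / Suc n\<close>.\<close>

lemma ennreal_gradient_modulus_eq_INF:
  assumes L: "L-lipschitz_on UNIV f" and h: "0 < h"
  shows "ennreal (gradient_modulus f x) = (INF n. local_slope f (h / Suc n) x)"
proof -
  have eq: "Limsup (at x) (\<lambda>y. ennreal (\<bar>f x - f y\<bar> / dist x y)) = (INF e\<in>{0<..}. local_slope f e x)"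
    unfolding Limsup_at local_slope_def ..
  also have "\<dots> = (INF n. local_slope f (h / Suc n) x)"
  proof (rule INF_eq)
    fix e :: real assume "e \<in> {0<..}"
    then obtain n where "h / e < real n" "0 < e" using reals_Archimedean2 by auto
    then have "h / real (Suc n) \<le> e" using h by (simp add: field_simps)
    then show "\<exists>n\<in>UNIV. local_slope f (h / real (Suc n)) x \<le> local_slope f e x"
      using local_slope_mono by blast
  qed (use h in auto)
  finally have *: "Limsup (at x) (\<lambda>y. ennreal (\<bar>f x - f y\<bar> / dist x y)) = (INF n. local_slope f (h / Suc n) x)" .
  have "(INF n. local_slope f (h / Suc n) x) \<le> ennreal L"
    using local_slope_le_lipschitz[OF L] by (meson INF_lower UNIV_I order_trans)
  then show ?thesis
    unfolding gradient_modulus_def * by (intro ennreal_enn2real) (metis ennreal_less_top le_less_trans)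
qed

lemma gradient_modulus_nonneg: "0 \<le> gradient_modulus f x"
  unfolding gradient_modulus_def by simp

lemma gradient_modulus_le_lipschitz:
  assumes "L-lipschitz_on UNIV f"
  shows "gradient_modulus f x \<le> L"
proof -
  have "ennreal (gradient_modulus f x) \<le> ennreal L"
    unfolding ennreal_gradient_modulus_eq_INF[OF assms zero_less_one]
    using local_slope_le_lipschitz[OF assms] by (meson INF_lower UNIV_I order_trans)
  moreover have "0 \<le> L" using assms by (simp add: lipschitz_on_def)
  ultimately show ?thesis by simp
qed

lemma gradient_modulus_uminus: "gradient_modulus (\<lambda>x. - f x) = gradient_modulus f"
  unfolding gradient_modulus_def by (intro ext) (simp add: abs_minus_commute)

lemma gradient_modulus_diff_const: "gradient_modulus (\<lambda>x. f x - c) = gradient_modulus f"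
  unfolding gradient_modulus_def by simp

text \<open>The slope at a fixed scale is lower semicontinuous: its superlevel sets are unions over
  \<open>y\<close> of open sets, because the difference quotient with \<open>y\<close> is continuous
  on the punctured ball around \<open>y\<close>.\<close>

lemma borel_measurable_local_slope:
  fixes f :: "'a::metric_space \<Rightarrow> real"
  assumes "continuous_on UNIV f"
  shows "local_slope f h \<in> borel_measurable borel"
proof (rule borel_measurableI_greater)
  fix c
  let ?B = "\<lambda>y. ball y h - {y}"
  have "{x \<in> space borel. c < local_slope f h x} =
    (\<Union>y. (\<lambda>x. ennreal (\<bar>f x - f y\<bar> / dist x y)) -` {c<..} \<inter> ?B y)"
    unfolding local_slope_def by (auto simp: less_SUP_iff dist_commute)
  moreover have "open ((\<lambda>x. ennreal (\<bar>f x - f y\<bar> / dist x y)) -` {c<..} \<inter> ?B y)" for y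
  proof -
    have o: "open (?B y)" by (intro open_Diff) auto
    have "continuous_on (?B y) f" using assms continuous_on_subset by blast
    then have "continuous_on (?B y) (\<lambda>x. ennreal (\<bar>f x - f y\<bar> / dist x y))"
      by (intro continuous_on_ennreal continuous_intros) auto
    then show ?thesis
      using continuous_on_open_vimage[OF o] open_greaterThan by blast
  qed
  ultimately show "{x \<in> space borel. c < local_slope f h x} \<in> sets borel"
    by (auto intro!: borel_open)
qed

lemma borel_measurable_gradient_modulus:
  assumes "L-lipschitz_on UNIV f"
  shows "gradient_modulus f \<in> borel_measurable borel"
proof -
  have [measurable]: "local_slope f h \<in> borel_measurable borel" for h
    by (rule borel_measurable_local_slope) (rule lipschitz_on_continuous_on[OF assms])
  have "gradient_modulus f x = enn2real (INF n. local_slope f (1 / Suc n) x)" for x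
    using ennreal_gradient_modulus_eq_INF[OF assms zero_less_one, of x] gradient_modulus_nonneg[of f x]
    by (metis enn2real_ennreal)
  then have "gradient_modulus f = (\<lambda>x. enn2real (INF n. local_slope f (1 / Suc n) x))" by auto
  then show ?thesis by simp
qed

section \<open>A coarea lower bound from the Minkowski content\<close>

text \<open>Used to pass from the limes inferior over all \<open>h\<close> in the Minkowski content
  to one along a sequence, where Fatou's lemma is available.\<close>

lemma Liminf_le_Liminf_filterlim:
  fixes g :: "'b \<Rightarrow> 'c::complete_lattice"
  assumes "filterlim u F G"
  shows "Liminf F g \<le> Liminf G (\<lambda>n. g (u n))"
proof -
  have "Liminf F g \<le> Liminf (filtermap u G) g"
    unfolding Liminf_def using assms by (intro SUP_subset_mono) (auto simp: filterlim_def le_filter_def)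
  also have "\<dots> \<le> Liminf G (\<lambda>n. g (u n))" by (rule Liminf_filtermap_le)
  finally show ?thesis .
qed

text \<open>Integrating \<open>(\<mu>({f > s}\<^sub>h) - \<mu>{f > s}) / h\<close> over \<open>s\<close> gives at most the integral of the slope of
  \<open>f\<close> at scale \<open>h\<close> by Tonelli; the left end point \<open>a\<close> is approached from the right because the level set
  \<open>{f = a}\<close> may have positive measure and positive slope.\<close>

lemma coarea_lower_bound_aux:
  fixes M :: "'a::metric_space measure"
  assumes M: "sets M = sets borel"
    and L: "L-lipschitz_on UNIV f"
    and ab: "a < a'" "a' < b"
    and fin: "emeasure M {x. a < f x} < \<infinity>"
    and c: "0 \<le> c" "\<And>s. a' \<le> s \<Longrightarrow> s < b \<Longrightarrow> ennreal c \<le> minkowski_content M {x. s < f x}"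
  shows "ennreal (c * (b - a')) \<le> (\<integral>\<^sup>+x\<in>{x. a < f x \<and> f x < b}. ennreal (gradient_modulus f x) \<partial>M)"
proof -
  have L0: "0 \<le> L" using L by (simp add: lipschitz_on_def)
  \<comment> \<open>This choice gives \<open>L * h n < a' - a\<close>, so that enlarging
    \<open>{s < f}\<close> with \<open>a' \<le> s\<close> by \<open>h n\<close> does not leave
    \<open>{a < f}\<close>. The denominator \<open>L + 1\<close> also covers
    \<open>L = 0\<close>.\<close>
  define h0 where "h0 = (a' - a) / (L + 1)"
  define h where "h n = h0 / Suc n" for n
  have h0: "0 < h0" using ab L0 by (simp add: h0_def)
  have h: "0 < h n" "h n \<le> h0" for n using h0 by (auto simp: h_def divide_le_eq mult_le_cancel_left1)
  have Lh: "L * h n < a' - a" for n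
  proof -
    have "L * h n \<le> L * h0" using h L0 by (intro mult_left_mono)
    also have "\<dots> < (L + 1) * h0" using h0 by (simp add: algebra_simps)
    also have "\<dots> = a' - a" using L0 by (simp add: h0_def)
    finally show ?thesis .
  qed
  have h_lim: "filterlim h (at_right 0) sequentially"
  proof -
    have "(\<lambda>n. h0 * (1 / Suc n)) \<longlonglongrightarrow> h0 * 0"
      by (intro tendsto_intros LIMSEQ_Suc[OF lim_1_over_n])
    then show ?thesis using h(1) unfolding filterlim_at h_def[abs_def] by auto
  qed
  have sp: "space M = UNIV" using M sets_eq_imp_space_eq by fastforce
  have cf: "continuous_on UNIV f" using L by (rule lipschitz_on_continuous_on)
  have [measurable]: "f \<in> borel_measurable M" "local_slope f e \<in> borel_measurable M" for e
    using borel_measurable_continuous_onI[OF cf] borel_measurable_local_slope[OF cf] M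
    by (auto cong: measurable_cong_sets)
  have Coll: "{x. P x} \<in> sets M" if "Measurable.pred M P" for P
    using that sp unfolding pred_def by simp
  have [measurable]: "{x. a < f x} \<in> sets M" "{x. f x < b} \<in> sets M" "{x. a < f x \<and> f x < b} \<in> sets M"
    by (rule Coll, measurable)+
  \<comment> \<open>Restricted to \<open>{a < f}\<close> the measure is finite, which permits
    Tonelli on the product with Lebesgue measure although \<open>M\<close> is not known to be
    sigma-finite.\<close>
  define N where "N = density M (indicator {x. a < f x})"
  have [measurable_cong, simp]: "sets N = sets M" by (simp add: N_def)
  have spN: "space N = UNIV" using sp by (simp add: N_def)
  have eN: "emeasure N A = emeasure M ({x. a < f x} \<inter> A)" if "A \<in> sets M" for A
    unfolding N_def using that sp by (subst emeasure_density) (auto simp flip: indicator_inter_arith nn_integral_indicator)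
  interpret N: finite_measure N
    by standard (use fin eN[of UNIV] sp sets.top[of M] in \<open>auto simp: spN\<close>)
  interpret P: pair_sigma_finite lborel N ..
  \<comment> \<open>The set \<open>E n s\<close> contains all points that the enlargement by
    \<open>h n\<close> adds to \<open>{s < f}\<close>. For fixed \<open>x\<close>, the levels
    \<open>s\<close> with \<open>x \<in> E n s\<close> form an interval whose length is
    \<open>h n\<close> times the slope at \<open>x\<close>.\<close>
  define E where "E n s = {x. f x \<le> s \<and> s < f x + h n * enn2real (local_slope f (h n) x)}" for n s
  have E_meas [measurable]: "E n s \<in> sets M" for n s
  proof -
    have "{x \<in> space M. f x \<le> s \<and> s < f x + h n * enn2real (local_slope f (h n) x)} \<in> sets M"
      by measurable
    then show ?thesis unfolding E_def sp by simp
  qed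
  have quot: "(emeasure M (enlarge {x. s < f x} (h n)) - emeasure M {x. s < f x}) / ennreal (h n)
      \<le> emeasure N (E n s) / ennreal (h n)" if s: "a' \<le> s" "s < b" for n s
  proof -
    let ?A = "{x. s < f x}" and ?B = "enlarge {x. s < f x} (h n)"
    have AB: "?A \<subseteq> ?B" unfolding enlarge_def using h(1)[of n] by force
    have A: "?A \<in> sets M" by (rule Coll) measurable
    have B: "?B \<in> sets M" unfolding enlarge_def M by (intro borel_open) auto
    have "emeasure M ?A \<le> emeasure M {x. a < f x}"
      using s ab by (intro emeasure_mono) auto
    then have "emeasure M ?A \<noteq> \<infinity>" using fin by auto
    then have "emeasure M ?B - emeasure M ?A = emeasure M (?B - ?A)"
      by (intro emeasure_Diff[symmetric] A B AB)
    also have "?B - ?A \<subseteq> {x. a < f x} \<inter> E n s"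
    proof safe
      fix x assume x: "x \<in> ?B" "\<not> s < f x"
      then obtain y where y: "s < f y" "dist y x < h n" unfolding enlarge_def by auto
      have "\<bar>f y - f x\<bar> \<le> L * dist y x" using lipschitz_on_abs_diff_le[OF L] .
      also have "\<dots> \<le> L * h n" using y L0 by (intro mult_left_mono) auto
      finally show "a < f x" using Lh[of n] y s by auto
      have "\<bar>f x - f y\<bar> \<le> h n * enn2real (local_slope f (h n) x)"
        using y by (intro abs_diff_le_local_slope[OF L]) (simp add: dist_commute)
      then show "x \<in> E n s" using x y unfolding E_def by auto
    qed
    then have "emeasure M (?B - ?A) \<le> emeasure N (E n s)"
      by (subst eN) (auto intro!: emeasure_mono sets.Int simp: sp)
    finally show ?thesis by (rule divide_right_mono_ennreal)
  qed
  have set1: "{p. fst p \<in> {a'..<b} \<and> snd p \<in> E n (fst p)} \<in> sets (lborel \<Otimes>\<^sub>M N)" for n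
  proof -
    have "{p \<in> space (lborel \<Otimes>\<^sub>M N). fst p \<in> {a'..<b} \<and> snd p \<in> E n (fst p)} \<in> sets (lborel \<Otimes>\<^sub>M N)"
      unfolding E_def by measurable
    then show ?thesis by (simp add: space_pair_measure spN)
  qed
  let ?X = "\<lambda>n. indicator {p. fst p \<in> {a'..<b} \<and> snd p \<in> E n (fst p)} :: real \<times> 'a \<Rightarrow> ennreal"
  have X_int: "(\<integral>\<^sup>+x. ?X n (s, x) \<partial>N) = indicator {a'..<b} s * emeasure N (E n s)" for n s
  proof -
    have "(\<integral>\<^sup>+x. ?X n (s, x) \<partial>N) = (\<integral>\<^sup>+x. indicator {a'..<b} s * indicator (E n s) x \<partial>N)"
      by (intro nn_integral_cong) (auto simp: indicator_def)
    then show ?thesis by (simp add: nn_integral_cmult)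
  qed
  have "(\<lambda>s. \<integral>\<^sup>+x. ?X n (s, x) \<partial>N) \<in> borel_measurable lborel" for n
    using set1[of n] by (intro N.borel_measurable_nn_integral_fst) simp
  then have meas1 [measurable]: "(\<lambda>s. indicator {a'..<b} s * emeasure N (E n s)) \<in> borel_measurable lborel" for n
    unfolding X_int .
  have step: "(\<integral>\<^sup>+s. indicator {a'..<b} s * emeasure N (E n s) \<partial>lborel) / ennreal (h n)
    \<le> (\<integral>\<^sup>+x\<in>{x. a < f x \<and> f x < b}. local_slope f (h n) x \<partial>M)" for n
  proof -
    have fin': "local_slope f (h n) x < top" for x
      using local_slope_le_lipschitz[OF L, of "h n" x] by (metis ennreal_less_top le_less_trans)
    have "(\<integral>\<^sup>+s. indicator {a'..<b} s * emeasure N (E n s) \<partial>lborel) = (\<integral>\<^sup>+s. \<integral>\<^sup>+x. ?X n (s, x) \<partial>N \<partial>lborel)"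
      unfolding X_int ..
    also have "\<dots> = (\<integral>\<^sup>+x. \<integral>\<^sup>+s. ?X n (s, x) \<partial>lborel \<partial>N)"
      using set1[of n] by (intro P.Fubini[symmetric]) simp
    also have "\<dots> \<le> (\<integral>\<^sup>+x. ennreal (h n) * local_slope f (h n) x * indicator {x. f x < b} x \<partial>N)"
    proof (intro nn_integral_mono)
      fix x
      let ?r = "h n * enn2real (local_slope f (h n) x)"
      have r: "0 \<le> ?r" using h(1)[of n] by simp
      have "(\<integral>\<^sup>+s. ?X n (s, x) \<partial>lborel) \<le> (\<integral>\<^sup>+s. indicator {x. f x < b} x * indicator {f x..<f x + ?r} s \<partial>lborel)"
        by (intro nn_integral_mono) (auto simp: indicator_def E_def)
      also have "\<dots> = ennreal ?r * indicator {x. f x < b} x"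
        using r by (simp add: nn_integral_cmult mult.commute)
      also have "ennreal ?r = ennreal (h n) * local_slope f (h n) x"
        using h(1)[of n] fin' by (simp add: ennreal_mult)
      finally show "(\<integral>\<^sup>+s. ?X n (s, x) \<partial>lborel) \<le> ennreal (h n) * local_slope f (h n) x * indicator {x. f x < b} x" .
    qed
    also have "\<dots> = (\<integral>\<^sup>+x. ennreal (h n) * (local_slope f (h n) x * indicator {x. a < f x \<and> f x < b} x) \<partial>M)"
      unfolding N_def using sp by (subst nn_integral_density) (auto simp: indicator_def intro!: nn_integral_cong)
    also have "\<dots> = ennreal (h n) * (\<integral>\<^sup>+x\<in>{x. a < f x \<and> f x < b}. local_slope f (h n) x \<partial>M)"
      by (rule nn_integral_cmult) measurable
    finally have *: "(\<integral>\<^sup>+s. indicator {a'..<b} s * emeasure N (E n s) \<partial>lborel) \<le> ennreal (h n) * (\<integral>\<^sup>+x\<in>{x. a < f x \<and> f x < b}. local_slope f (h n) x \<partial>M)" .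
    show ?thesis
      using divide_right_mono_ennreal[OF *, of "ennreal (h n)"] h(1)[of n]
      by (subst (asm) mult.commute[of "ennreal (h n)"]) (simp add: mult_divide_eq_ennreal)
  qed
  have "ennreal (c * (b - a')) = (\<integral>\<^sup>+s. ennreal c * indicator {a'..<b} s \<partial>lborel)"
    using ab c by (simp add: nn_integral_cmult ennreal_mult)
  also have "\<dots> \<le> (\<integral>\<^sup>+s. liminf (\<lambda>n. indicator {a'..<b} s * emeasure N (E n s) / ennreal (h n)) \<partial>lborel)"
  proof (intro nn_integral_mono)
    fix s :: real
    show "ennreal c * indicator {a'..<b} s \<le> liminf (\<lambda>n. indicator {a'..<b} s * emeasure N (E n s) / ennreal (h n))"
    proof (cases "s \<in> {a'..<b}")
      case True
      then have "ennreal c \<le> minkowski_content M {x. s < f x}" using c by auto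
      also have "\<dots> \<le> liminf (\<lambda>n. (emeasure M (enlarge {x. s < f x} (h n)) - emeasure M {x. s < f x}) / ennreal (h n))"
        unfolding minkowski_content_def by (rule Liminf_le_Liminf_filterlim[OF h_lim])
      also have "\<dots> \<le> liminf (\<lambda>n. emeasure N (E n s) / ennreal (h n))"
        using True by (intro Liminf_mono always_eventually allI quot) auto
      finally show ?thesis using True by simp
    qed simp
  qed
  also have "\<dots> \<le> liminf (\<lambda>n. \<integral>\<^sup>+s. indicator {a'..<b} s * emeasure N (E n s) / ennreal (h n) \<partial>lborel)"
    by (rule nn_integral_liminf) measurable
  also have "\<dots> \<le> liminf (\<lambda>n. \<integral>\<^sup>+x\<in>{x. a < f x \<and> f x < b}. local_slope f (h n) x \<partial>M)"
    using step by (intro Liminf_mono always_eventually allI) (subst nn_integral_divide, auto)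
  also have "\<dots> = (INF n. \<integral>\<^sup>+x\<in>{x. a < f x \<and> f x < b}. local_slope f (h n) x \<partial>M)"
    by (intro lim_imp_Liminf LIMSEQ_INF decseq_SucI nn_integral_mono mult_right_mono local_slope_mono)
       (use h0 in \<open>auto simp: h_def frac_le\<close>)
  \<comment> \<open>Downward monotone convergence needs one finite integral; it comes from the bound
    \<open>L\<close> on the slopes and the finite measure of \<open>{a < f}\<close>.\<close>
  also have "\<dots> = (\<integral>\<^sup>+x. (INF n. local_slope f (h n) x * indicator {x. a < f x \<and> f x < b} x) \<partial>M)"
  proof (rule nn_integral_monotone_convergence_INF_decseq[symmetric])
    show "decseq (\<lambda>n x. local_slope f (h n) x * indicator {x. a < f x \<and> f x < b} x)"
      by (intro decseq_SucI le_funI mult_right_mono local_slope_mono)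
         (use h0 in \<open>auto simp: h_def frac_le\<close>)
    have "(\<integral>\<^sup>+x\<in>{x. a < f x \<and> f x < b}. local_slope f (h 0) x \<partial>M) \<le> (\<integral>\<^sup>+x. ennreal L * indicator {x. a < f x} x \<partial>M)"
      by (intro nn_integral_mono) (auto simp: indicator_def local_slope_le_lipschitz[OF L])
    also have "\<dots> = ennreal L * emeasure M {x. a < f x}"
      by (rule nn_integral_cmult_indicator) measurable
    also have "\<dots> < \<infinity>" using fin by (simp add: ennreal_mult_less_top)
    finally show "(\<integral>\<^sup>+x\<in>{x. a < f x \<and> f x < b}. local_slope f (h 0) x \<partial>M) < \<infinity>" .
  qed measurable
  also have "\<dots> = (\<integral>\<^sup>+x\<in>{x. a < f x \<and> f x < b}. ennreal (gradient_modulus f x) \<partial>M)"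
    by (intro nn_integral_cong)
       (auto simp: indicator_def ennreal_gradient_modulus_eq_INF[OF L h0] h_def)
  finally show ?thesis .
qed

text \<open>The right-hand side of the preceding bound does not depend on the intermediate level
  \<open>a'\<close>, so \<open>a'\<close> may decrease to \<open>a\<close>.\<close>

lemma coarea_lower_bound:
  fixes M :: "'a::metric_space measure"
  assumes M: "sets M = sets borel"
    and L: "L-lipschitz_on UNIV f"
    and ab: "a < b"
    and fin: "emeasure M {x. a < f x} < \<infinity>"
    and c: "0 \<le> c" "\<And>s. a \<le> s \<Longrightarrow> s < b \<Longrightarrow> ennreal c \<le> minkowski_content M {x. s < f x}"
  shows "ennreal (c * (b - a)) \<le> (\<integral>\<^sup>+x\<in>{x. a < f x \<and> f x < b}. ennreal (gradient_modulus f x) \<partial>M)"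
proof (rule tendsto_upperbound[of _ _ "at_right a"])
  show "((\<lambda>a'. ennreal (c * (b - a'))) \<longlongrightarrow> ennreal (c * (b - a))) (at_right a)"
    by (intro tendsto_intros tendsto_ennrealI)
  show "\<forall>\<^sub>F a' in at_right a. ennreal (c * (b - a')) \<le> (\<integral>\<^sup>+x\<in>{x. a < f x \<and> f x < b}. ennreal (gradient_modulus f x) \<partial>M)"
    using eventually_at_right_real[OF ab]
    by eventually_elim (auto intro!: coarea_lower_bound_aux[OF M L _ _ fin] c)
qed simp

section \<open>The layer-cake formula and integrals of rearrangements\<close>

text \<open>Tonelli on the region under the graph of \<open>u\<close>. The measure is first
  restricted to \<open>{0 < u}\<close>, where the integral lives and where it is finite by
  \<open>fin\<close>.\<close>

lemma nn_integral_layer_cake: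
  assumes u [measurable]: "u \<in> borel_measurable M"
    and fin: "distribution_fun M u 0 < \<infinity>"
  shows "(\<integral>\<^sup>+x. u x \<partial>M) = (\<integral>\<^sup>+t. indicator {0<..} t * distribution_fun M u (ennreal t) \<partial>lborel)"
proof -
  let ?S = "{x \<in> space M. 0 < u x}"
  define N where "N = density M (indicator ?S)"
  have [measurable_cong, simp]: "sets N = sets M" by (simp add: N_def)
  have spN: "space N = space M" by (simp add: N_def)
  have eN: "emeasure N A = emeasure M (?S \<inter> A)" if "A \<in> sets M" for A
    unfolding N_def using that by (subst emeasure_density) (auto simp flip: indicator_inter_arith nn_integral_indicator)
  have "emeasure N (space N) = emeasure M ?S"
    unfolding spN by (subst eN) (auto intro!: arg_cong[where f="emeasure M"])
  then interpret N: finite_measure N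
    using fin by (intro finite_measureI) (auto simp: distribution_fun_def)
  interpret P: pair_sigma_finite lborel N ..
  let ?X = "indicator {p \<in> space (lborel \<Otimes>\<^sub>M N). 0 < fst p \<and> ennreal (fst p) < u (snd p)} :: real \<times> _ \<Rightarrow> ennreal"
  have X: "?X \<in> borel_measurable (lborel \<Otimes>\<^sub>M N)" by measurable
  have "(\<integral>\<^sup>+x. u x \<partial>M) = (\<integral>\<^sup>+x. u x \<partial>N)"
    unfolding N_def by (subst nn_integral_density) (auto simp: indicator_def intro!: nn_integral_cong)
  also have "\<dots> = (\<integral>\<^sup>+x. \<integral>\<^sup>+t. ?X (t, x) \<partial>lborel \<partial>N)"
  proof (rule nn_integral_cong)
    fix x assume "x \<in> space N"
    then have "(\<integral>\<^sup>+t. ?X (t, x) \<partial>lborel) = (\<integral>\<^sup>+t. indicator {t. 0 < t \<and> ennreal t < u x} t \<partial>lborel)"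
      by (intro nn_integral_cong) (auto simp: indicator_def space_pair_measure)
    then show "u x = (\<integral>\<^sup>+t. ?X (t, x) \<partial>lborel)"
      by (simp add: emeasure_initial_interval)
  qed
  also have "\<dots> = (\<integral>\<^sup>+t. \<integral>\<^sup>+x. ?X (t, x) \<partial>N \<partial>lborel)"
    using X by (rule P.Fubini)
  also have "\<dots> = (\<integral>\<^sup>+t. indicator {0<..} t * distribution_fun M u (ennreal t) \<partial>lborel)"
  proof (rule nn_integral_cong)
    fix t :: real
    have "(\<integral>\<^sup>+x. ?X (t, x) \<partial>N) = (\<integral>\<^sup>+x. indicator {0<..} t * indicator {x \<in> space M. ennreal t < u x} x \<partial>N)"
      by (intro nn_integral_cong) (auto simp: indicator_def space_pair_measure spN)
    also have "\<dots> = indicator {0<..} t * emeasure N {x \<in> space M. ennreal t < u x}"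
      by (simp add: nn_integral_cmult)
    also have "emeasure N {x \<in> space M. ennreal t < u x} = distribution_fun M u (ennreal t)"
      unfolding distribution_fun_def
      by (subst eN) (auto intro!: arg_cong[where f="emeasure M"] elim: le_less_trans[rotated])
    finally show "(\<integral>\<^sup>+x. ?X (t, x) \<partial>N) = indicator {0<..} t * distribution_fun M u (ennreal t)" .
  qed
  finally show ?thesis .
qed

lemma distribution_fun_antimono:
  assumes [measurable]: "u \<in> borel_measurable M" and "l \<le> l'"
  shows "distribution_fun M u l' \<le> distribution_fun M u l"
  unfolding distribution_fun_def
  using assms by (intro emeasure_mono) (auto intro: le_less_trans)

text \<open>The rearrangement vanishes beyond \<delta>, so cutting it off there leaves a function on
  the line with the same distribution function as \<open>u\<close>. The layer-cake formula on both
  sides then gives equal integrals.\<close>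

lemma nn_integral_rearrangement:
  assumes u [measurable]: "u \<in> borel_measurable M"
    and \<delta>: "distribution_fun M u 0 \<le> ennreal \<delta>"
  shows "(\<integral>\<^sup>+s\<in>{0<..<\<delta>}. rearrangement M u s \<partial>lborel) = (\<integral>\<^sup>+x. u x \<partial>M)"
proof -
  let ?r = "\<lambda>s. rearrangement M u s * indicator {0<..<\<delta>} s"
  have eq: "distribution_fun lborel ?r l = distribution_fun M u l" for l
  proof -
    have le: "distribution_fun M u l \<le> ennreal \<delta>"
      using distribution_fun_antimono[OF u, of 0 l] \<delta> by (meson order_trans zero_le)
    then have lt: "s < \<delta>" if "ennreal s < distribution_fun M u l" "0 < s" for s
    proof -
      have "ennreal s < ennreal \<delta>" using that(1) le by (rule less_le_trans)
      then show ?thesis using that(2) by (simp add: ennreal_less_iff)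
    qed
    have "{s \<in> space lborel. l < ?r s} = {s. 0 < s \<and> ennreal s < distribution_fun M u l}"
      using lt by (auto simp: indicator_def less_rearrangement_iff[OF u] split: if_splits)
    then show ?thesis
      unfolding distribution_fun_def[of lborel] by (simp add: emeasure_initial_interval)
  qed
  have fin: "distribution_fun M u 0 < \<infinity>" using \<delta> by (metis ennreal_less_top infinity_ennreal_def le_less_trans)
  have "(\<integral>\<^sup>+s. ?r s \<partial>lborel) = (\<integral>\<^sup>+t. indicator {0<..} t * distribution_fun lborel ?r (ennreal t) \<partial>lborel)"
    by (rule nn_integral_layer_cake) (use fin in \<open>simp_all add: eq\<close>)
  also have "\<dots> = (\<integral>\<^sup>+x. u x \<partial>M)"
    unfolding eq using nn_integral_layer_cake[OF u fin] by simp
  finally show ?thesis .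
qed

lemma emeasure_shifted_initial_interval: "emeasure lborel {s::real. a < s \<and> ennreal (s - a) < c} = c"
proof -
  have "(\<lambda>s. a + s) -` {s::real. a < s \<and> ennreal (s - a) < c} = {t. 0 < t \<and> ennreal t < c}"
    by auto
  moreover have "{s::real. a < s \<and> ennreal (s - a) < c} \<in> sets borel" by measurable
  ultimately have "emeasure (distr lborel borel (\<lambda>s. a + s)) {s::real. a < s \<and> ennreal (s - a) < c} =
    emeasure lborel {t. 0 < t \<and> ennreal t < c}"
    by (subst emeasure_distr) auto
  then show ?thesis
    by (simp add: lborel_distr_plus emeasure_initial_interval)
qed

lemma nn_integral_shift_interval:
  fixes g :: "real \<Rightarrow> ennreal"
  assumes [measurable]: "g \<in> borel_measurable borel"
  shows "(\<integral>\<^sup>+s\<in>{a<..<a + \<delta>}. g (s - a) \<partial>lborel) = (\<integral>\<^sup>+s\<in>{0<..<\<delta>}. g s \<partial>lborel)"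
proof -
  have "(\<integral>\<^sup>+s\<in>{a<..<a + \<delta>}. g (s - a) \<partial>lborel) = (\<integral>\<^sup>+s\<in>{a<..<a + \<delta>}. g (s - a) \<partial>distr lborel borel (\<lambda>s. a + s))"
    by (simp add: lborel_distr_plus)
  also have "\<dots> = (\<integral>\<^sup>+s\<in>{0<..<\<delta>}. g s \<partial>lborel)"
    by (subst nn_integral_distr) (auto simp: indicator_def intro!: nn_integral_cong)
  finally show ?thesis .
qed

section \<open>Monotonicity of the isoperimetric profile and of its quotient\<close>

lemma profile_dom_subset:
  assumes "t \<in> profile_dom M" "0 \<le> s" "s \<le> t"
  shows "s \<in> profile_dom M"
  using assms le_less_trans[OF ennreal_leI, of s t] unfolding profile_dom_def by auto

lemma half_in_profile_dom:
  assumes m: "0 < m" "ennreal m \<le> emeasure M (space M) / 2"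
  shows "m \<in> profile_dom M"
proof (cases "emeasure M (space M)")
  case (real r)
  then have "ennreal m \<le> ennreal (r / 2)"
    using m by (metis divide_ennreal ennreal_numeral zero_le_numeral zero_less_numeral)
  then have "m \<le> r / 2" using m real by (simp add: ennreal_le_iff2)
  then show ?thesis using m real by (simp add: profile_dom_def ennreal_less_iff)
next
  case top
  then show ?thesis using m by (simp add: profile_dom_def)
qed

lemma ennreal_profile:
  assumes "profile_conditions M" "t \<in> profile_dom M"
  shows "ennreal (profile M t) = profile_ennreal M t"
  using assms unfolding profile_conditions_def profile_def by (intro ennreal_enn2real) auto

lemma profile_pos:
  assumes "profile_conditions M" "t \<in> profile_dom M" "0 < t"
  shows "0 < profile M t"
  using assms unfolding profile_conditions_def by auto

text \<open>Concavity on the segment from 0 to \<open>t\<close> together with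
  \<open>I(0) = 0\<close> gives \<open>I(s) \<ge> (s/t) I(t)\<close>.\<close>

lemma profile_quotient_mono:
  assumes prof: "profile_conditions M" and t: "t \<in> profile_dom M" and s: "0 < s" "s \<le> t"
  shows "s / profile M s \<le> t / profile M t"
proof -
  have s': "s \<in> profile_dom M" using profile_dom_subset[OF t] s by auto
  have z: "0 \<in> profile_dom M" using profile_dom_subset[OF t] s by auto
  have "u * profile M x + v * profile M y \<le> profile M (u *\<^sub>R x + v *\<^sub>R y)"
    if "x \<in> profile_dom M" "y \<in> profile_dom M" "0 \<le> u" "0 \<le> v" "u + v = 1" for x y u v
    using prof that unfolding profile_conditions_def concave_on_iff by blast
  from this[OF t z, of "s / t" "1 - s / t"]
  have "(s / t) * profile M t + (1 - s / t) * profile M 0 \<le> profile M s"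
    using s by simp
  then have "(s / t) * profile M t \<le> profile M s"
    using prof s unfolding profile_conditions_def by simp
  then show ?thesis
    using profile_pos[OF prof t] profile_pos[OF prof s'] s by (simp add: field_simps)
qed

text \<open>If the total mass \<open>r\<close> is finite, then \<open>t\<close> lies between
  \<open>s\<close> and its mirror image \<open>r - s\<close>, where the profile takes the same
  value, and concavity applies. If it is infinite, monotonicity is assumed.\<close>

lemma profile_mono_below_half:
  assumes prof: "profile_conditions M" and t: "0 < s" "s \<le> t" "ennreal t \<le> emeasure M (space M) / 2"
  shows "profile M s \<le> profile M t"
proof (cases "emeasure M (space M)")
  case top
  have "t \<in> profile_dom M" "s \<in> profile_dom M" using t top by (auto simp: profile_dom_def)
  then show ?thesis using prof t top unfolding profile_conditions_def mono_on_def by auto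
next
  case (real r)
  then have "ennreal t \<le> ennreal (r / 2)"
    using t by (metis divide_ennreal ennreal_numeral zero_le_numeral zero_less_numeral)
  then have tr: "t \<le> r / 2" using t real by (simp add: ennreal_le_iff2)
  show ?thesis
  proof (cases "s = t")
    case False
    then have st: "s < t" "0 < r - 2 * s" using t tr by auto
    have r: "measure M (space M) = r" using real by (simp add: measure_def)
    have dom: "s \<in> profile_dom M" "r - s \<in> profile_dom M"
      using t tr real st by (auto simp: profile_dom_def ennreal_less_iff)
    have sym: "profile M (r - s) = profile M s"
      using prof real r t tr st unfolding profile_conditions_def by auto
    \<comment> \<open>The weights solve \<open>u + v = 1\<close> and
      \<open>u * s + v * (r - s) = t\<close>.\<close>
    define u where "u = (r - s - t) / (r - 2 * s)"
    define v where "v = (t - s) / (r - 2 * s)"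
    have uv: "0 \<le> u" "0 \<le> v" "u + v = 1" using st tr by (auto simp: u_def v_def add_divide_distrib[symmetric])
    have "u * s + v * (r - s) = ((r - s - t) * s + (t - s) * (r - s)) / (r - 2 * s)"
      by (simp add: u_def v_def add_divide_distrib)
    also have "(r - s - t) * s + (t - s) * (r - s) = t * (r - 2 * s)" by (simp add: algebra_simps)
    finally have comb: "u * s + v * (r - s) = t" using st by simp
    have "u * profile M s + v * profile M (r - s) \<le> profile M (u * s + v * (r - s))"
      using prof dom uv unfolding profile_conditions_def concave_on_iff by auto
    then have "(u + v) * profile M s \<le> profile M t"
      unfolding comb sym by (simp add: algebra_simps)
    then show ?thesis using uv by simp
  qed simp
qed

section \<open>The isoperimetric Hardy operator and the two function norms\<close>

lemma hardy_range_sets [measurable]: "hardy_range M t \<in> sets borel"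
  unfolding hardy_range_def by measurable

lemma hardy_range_subset_profile_dom: "hardy_range M 0 \<subseteq> profile_dom M"
proof
  fix s assume "s \<in> hardy_range M 0"
  then show "s \<in> profile_dom M"
    using half_in_profile_dom[of s M] unfolding hardy_range_def by (auto simp: less_imp_le)
qed

text \<open>The domain of integration depends on \<open>t\<close>. Written as an integral over the
  whole line against the indicator of \<open>{t < s}\<close>, it is a parameter integral of a
  jointly measurable function.\<close>

lemma borel_measurable_isoperimetric_hardy:
  assumes prof: "profile_conditions M" and h [measurable]: "h \<in> borel_measurable borel"
  shows "isoperimetric_hardy M h \<in> borel_measurable borel"
proof -
  let ?R = "hardy_range M 0"
  \<comment> \<open>The profile is known to be continuous only on its domain; cut off outside the
    Hardy range it becomes Borel on the line.\<close>
  define J where "J s = indicator ?R s *\<^sub>R profile M s" for s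
  have "continuous_on ?R (profile M)"
    using prof hardy_range_subset_profile_dom continuous_on_subset unfolding profile_conditions_def by blast
  then have J [measurable]: "J \<in> borel_measurable borel"
    unfolding J_def[abs_def] by (intro borel_measurable_continuous_on_indicator) auto
  have eq: "isoperimetric_hardy M h t = indicator ?R t * (J t / t * (\<integral>s. indicator {p. fst p < snd p} (t, s) * (h s / J s) \<partial>lborel))" for t
  proof (cases "t \<in> ?R")
    case True
    have "(LINT s:hardy_range M t|lborel. h s / profile M s) = (\<integral>s. indicator {p. fst p < snd p} (t, s) * (h s / J s) \<partial>lborel)"
      unfolding set_lebesgue_integral_def
      by (intro Bochner_Integration.integral_cong) (use True in \<open>auto simp: indicator_def J_def hardy_range_def\<close>)
    then show ?thesis using True by (simp add: isoperimetric_hardy_def J_def)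
  qed (simp add: isoperimetric_hardy_def)
  have "{p::real \<times> real. fst p < snd p} \<in> sets (borel \<Otimes>\<^sub>M borel)"
    unfolding borel_prod by (intro borel_open open_Collect_less continuous_intros)
  then have [measurable]: "{p::real \<times> real. fst p < snd p} \<in> sets (borel \<Otimes>\<^sub>M lborel)"
    by (simp cong: sets_pair_measure_cong)
  show ?thesis
    unfolding eq[abs_def] by measurable
qed

text \<open>A bound \<open>B\<close> of the Hardy operator is fixed so that the constants below can
  be written explicitly in terms of it.\<close>

locale isoperimetric_hardy_space =
  fixes M :: "'a::metric_space measure"
    and \<rho> :: "('a \<Rightarrow> ennreal) \<Rightarrow> ennreal"
    and \<sigma> :: "(real \<Rightarrow> ennreal) \<Rightarrow> ennreal"
    and B :: real
  assumes sets_M [measurable_cong]: "sets M = sets borel"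
    and prof: "profile_conditions M"
    and ri: "ri_norm M \<rho>"
    and rep: "represents M \<rho> \<sigma>"
    and B_nonneg: "0 \<le> B"
    and hardy: "\<And>h. h \<in> borel_measurable (interval_measure_space M) \<Longrightarrow> norm_in \<sigma> h < \<infinity> \<Longrightarrow>
        (\<forall>t\<in>hardy_range M 0. set_integrable lborel (hardy_range M t) (\<lambda>s. h s / profile M s)) \<and>
        norm_in \<sigma> (isoperimetric_hardy M h) \<le> ennreal B * norm_in \<sigma> h"
begin

lemma space_M [simp]: "space M = UNIV"
  using sets_M sets_eq_imp_space_eq by fastforce

lemma Collect_in_sets_M: "Measurable.pred M P \<Longrightarrow> {x. P x} \<in> sets M"
  unfolding pred_def by simp

lemma borel_measurable_M: "f \<in> borel_measurable borel \<Longrightarrow> f \<in> borel_measurable M"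
  by (simp cong: measurable_cong_sets add: sets_M)

lemma ri_\<sigma>: "ri_norm (interval_measure_space M) \<sigma>"
  using rep unfolding represents_def by simp

text \<open>The four facts share the measurability assumptions on both functions; uses of the last
  two therefore put the zero function for \<open>g\<close>.\<close>

lemma
  assumes [measurable]: "f \<in> borel_measurable M" "g \<in> borel_measurable M"
  shows \<rho>_mono_AE: "(AE x in M. g x \<le> f x) \<Longrightarrow> \<rho> g \<le> \<rho> f"
    and \<rho>_add: "\<rho> (\<lambda>x. f x + g x) \<le> \<rho> f + \<rho> g"
    and \<rho>_scale: "0 \<le> c \<Longrightarrow> \<rho> (\<lambda>x. ennreal c * f x) = ennreal c * \<rho> f"
    and \<rho>_zero: "(AE x in M. f x = 0) \<Longrightarrow> \<rho> f = 0"
  using ri assms unfolding ri_norm_def banach_function_norm_def by blast+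

lemma \<rho>_mono:
  assumes "f \<in> borel_measurable M" "g \<in> borel_measurable M" "\<And>x. g x \<le> f x"
  shows "\<rho> g \<le> \<rho> f"
  using assms by (intro \<rho>_mono_AE) auto

lemma \<sigma>_mono:
  assumes "f \<in> borel_measurable (interval_measure_space M)" "g \<in> borel_measurable (interval_measure_space M)"
    "\<And>s. 0 < s \<Longrightarrow> ennreal s < emeasure M UNIV \<Longrightarrow> g s \<le> f s"
  shows "\<sigma> g \<le> \<sigma> f"
proof -
  have "AE s in interval_measure_space M. g s \<le> f s"
    using assms(3) by (intro AE_I2) (auto simp: space_interval_measure_space)
  then show ?thesis
    using ri_\<sigma> assms(1,2) unfolding ri_norm_def banach_function_norm_def by blast
qed

lemma \<sigma>_scale:
  assumes "f \<in> borel_measurable (interval_measure_space M)" "0 \<le> c"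
  shows "\<sigma> (\<lambda>x. ennreal c * f x) = ennreal c * \<sigma> f"
  using ri_\<sigma> assms unfolding ri_norm_def banach_function_norm_def by blast

lemma \<sigma>_Fatou:
  assumes "\<And>n. F n \<in> borel_measurable (interval_measure_space M)" "f \<in> borel_measurable (interval_measure_space M)"
    and "\<And>s. incseq (\<lambda>n. F n s)" "\<And>s. f s = (SUP n. F n s)"
  shows "\<sigma> f = (SUP n. \<sigma> (F n))"
proof -
  have "(\<forall>n::nat. F n \<in> borel_measurable (interval_measure_space M)) \<and> f \<in> borel_measurable (interval_measure_space M) \<and>
    (AE x in interval_measure_space M. incseq (\<lambda>n. F n x) \<and> f x = (SUP n. F n x))"
    using assms by auto
  then show ?thesis
    using ri_\<sigma> unfolding ri_norm_def banach_function_norm_def by blast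
qed

lemma \<rho>_eq_\<sigma>:
  assumes "f \<in> borel_measurable M" "AE x in M. f x < \<infinity>"
  shows "\<rho> f = \<sigma> (rearrangement M f)"
  using rep assms unfolding represents_def by blast

lemma borel_measurable_interval: "f \<in> borel_measurable borel \<Longrightarrow> f \<in> borel_measurable (interval_measure_space M)"
  by (rule measurable_interval_measure_space)

end

section \<open>The rearrangement of a positive part living on at most half of the space\<close>

text \<open>To be used for a function and for its negative. The number \<open>m\<close> will be half
  the total mass if that is finite, and a number exceeding the measure of the support
  otherwise.\<close>

locale positive_part_below_half = isoperimetric_hardy_space M \<rho> \<sigma> B
  for M :: "'a::metric_space measure" and \<rho> \<sigma> B +
  fixes f :: "'a::metric_space \<Rightarrow> real" and L b m :: real
  assumes L: "L-lipschitz_on UNIV f"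
    and f_le: "\<And>x. f x \<le> b"
    and m: "0 < m" "ennreal m \<le> emeasure M (space M) / 2"
    and support: "emeasure M {x. 0 < f x} \<le> ennreal m"
begin

lemma borel_measurable_f [measurable]: "f \<in> borel_measurable M"
  by (intro borel_measurable_M borel_measurable_continuous_onI lipschitz_on_continuous_on[OF L])

lemma borel_measurable_grad [measurable]: "gradient_modulus f \<in> borel_measurable M"
  by (intro borel_measurable_M borel_measurable_gradient_modulus[OF L])

lemma m_in_dom: "s \<in> profile_dom M" if "0 \<le> s" "s \<le> m"
  using profile_dom_subset[OF half_in_profile_dom[OF m] that] .

lemma sets_superlevel [measurable]: "{x. c < f x} \<in> sets M" "{x. c < f x \<and> f x < c'} \<in> sets M"
  by (rule Collect_in_sets_M, measurable)+

text \<open>Since \<open>ennreal\<close> sends negative numbers to 0, this is the rearrangement of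
  the positive part of \<open>f\<close>. It is finite because \<open>f \<le> b\<close>.\<close>

definition fstar :: "real \<Rightarrow> real" where
  "fstar t = enn2real (rearrangement M (\<lambda>x. ennreal (f x)) t)"

lemma distribution_fun_f:
  "0 \<le> s \<Longrightarrow> distribution_fun M (\<lambda>x. ennreal (f x)) (ennreal s) = emeasure M {x. s < f x}"
  unfolding distribution_fun_def by (simp add: ennreal_less_iff)

lemma ennreal_fstar: "ennreal (fstar t) = rearrangement M (\<lambda>x. ennreal (f x)) t"
proof -
  have e: "{x. max b 0 < f x} = {}" using f_le by (auto simp: not_less le_max_iff_disj)
  have "distribution_fun M (\<lambda>x. ennreal (f x)) (ennreal (max b 0)) = 0"
    by (subst distribution_fun_f, simp) (simp only: e emeasure_empty)
  then have "\<not> ennreal (max b 0) < rearrangement M (\<lambda>x. ennreal (f x)) t"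
    by (subst less_rearrangement_iff) auto
  then have "rearrangement M (\<lambda>x. ennreal (f x)) t < top"
    by (meson ennreal_less_top le_less_trans not_le)
  then show ?thesis unfolding fstar_def by simp
qed

lemma fstar_nonneg [simp]: "0 \<le> fstar t"
  unfolding fstar_def by simp

lemma less_fstar_iff: "0 \<le> s \<Longrightarrow> s < fstar t \<longleftrightarrow> ennreal t < emeasure M {x. s < f x}"
  using less_rearrangement_iff[of "\<lambda>x. ennreal (f x)" M "ennreal s" t]
  by (simp add: distribution_fun_f flip: ennreal_fstar) (simp add: ennreal_less_iff)

lemma fstar_antimono: "t \<le> t' \<Longrightarrow> fstar t' \<le> fstar t"
  using rearrangement_antimono[of t t' M "\<lambda>x. ennreal (f x)"] by (simp flip: ennreal_fstar)

lemma fstar_eq_0: "m \<le> t \<Longrightarrow> fstar t = 0"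
proof -
  assume "m \<le> t"
  then have "\<not> ennreal t < emeasure M {x. 0 < f x}"
    using support ennreal_leI[of m t] by (meson leD order_trans)
  then show "fstar t = 0" using less_fstar_iff[of 0 t] fstar_nonneg[of t] by linarith
qed

lemma superlevel_fstar_le: "emeasure M {x. fstar t < f x} \<le> ennreal t"
  using less_fstar_iff[of "fstar t" t] by simp

text \<open>For such a level \<open>s\<close> the set \<open>{s < f}\<close> has measure
  \<open>c\<close> with \<open>t' < c \<le> t\<close>, so its Minkowski content is at least
  \<open>I(c)\<close>, and \<open>I(t') \<le> I(c)\<close> because \<open>c\<close> is at most half
  of the total mass.\<close>

lemma profile_le_minkowski_content:
  assumes t: "0 < t'" "t' \<le> t" "t \<le> m" and s: "fstar t \<le> s" "s < fstar t'"
  shows "ennreal (profile M t') \<le> minkowski_content M {x. s < f x}"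
proof -
  have s0: "0 \<le> s" using s fstar_nonneg[of t] by linarith
  have lo: "ennreal t' < emeasure M {x. s < f x}" using less_fstar_iff[OF s0] s by simp
  have hi: "emeasure M {x. s < f x} \<le> ennreal t" using less_fstar_iff[OF s0, of t] s by (simp add: not_less)
  define c where "c = measure M {x. s < f x}"
  have c: "emeasure M {x. s < f x} = ennreal c"
    using hi unfolding c_def by (intro emeasure_eq_ennreal_measure) (auto simp: top_unique)
  have c0: "0 \<le> c" unfolding c_def by simp
  have c': "t' < c" "c \<le> t" using lo hi t c0 unfolding c by (auto simp: ennreal_less_iff ennreal_le_iff2)
  have "ennreal (profile M t') \<le> ennreal (profile M c)"
  proof (intro ennreal_leI profile_mono_below_half[OF prof])
    show "ennreal c \<le> emeasure M (space M) / 2"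
      using m(2) c' t ennreal_leI[of c m] by (metis order_trans)
  qed (use c' t in auto)
  also have "\<dots> = profile_ennreal M c"
    using c0 c' t by (intro ennreal_profile[OF prof] m_in_dom) auto
  also have "\<dots> \<le> minkowski_content M {x. s < f x}"
    unfolding profile_ennreal_def by (intro INF_lower) (auto simp: c)
  finally show ?thesis .
qed

text \<open>Both inequalities are strict. The level set at \<open>fstar t'\<close> may carry mass,
  and including it would destroy the bound \<open>t - t'\<close> on the measure of the slab.\<close>

definition slab :: "real \<Rightarrow> real \<Rightarrow> 'a \<Rightarrow> ennreal" where
  "slab t' t x = ennreal (gradient_modulus f x) * indicator {x. fstar t < f x \<and> f x < fstar t'} x"

lemma borel_measurable_slab [measurable]: "slab t' t \<in> borel_measurable M"
  unfolding slab_def[abs_def] by measurable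

text \<open>For a level \<open>r n\<close> between \<open>fstar t\<close> and
  \<open>fstar t'\<close>, the set \<open>{fstar t < f}\<close> has measure at most
  \<open>t\<close>, while \<open>{r n < f}\<close> has measure more than \<open>t'\<close>. The
  difference is at most \<open>t - t'\<close>, and \<open>r n\<close> increases to
  \<open>fstar t'\<close>.\<close>

lemma slab_support:
  assumes t: "0 < t'" "t' \<le> t"
  shows "emeasure M {x. fstar t < f x \<and> f x < fstar t'} \<le> ennreal (t - t')"
proof (cases "fstar t < fstar t'")
  case False
  then have "{x. fstar t < f x \<and> f x < fstar t'} = {}" by auto
  then show ?thesis by (simp only: emeasure_empty zero_le)
next
  case True
  let ?d = "fstar t' - fstar t"
  define r where "r n = fstar t' - ?d / Suc n" for n
  have r: "fstar t \<le> r n" "r n < fstar t'" for n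
    using True by (auto simp: r_def field_simps mult_left_mono)
  have "incseq r" unfolding r_def using True by (intro incseq_SucI) (auto simp: frac_le)
  have "r \<longlonglongrightarrow> fstar t' - ?d * 0"
    unfolding r_def[abs_def] divide_inverse
    using LIMSEQ_Suc[OF lim_1_over_n] by (intro tendsto_intros) (simp add: inverse_eq_divide)
  then have ex: "\<exists>n. y < r n" if "y < fstar t'" for y
    using order_tendstoD(1)[of r "fstar t'" sequentially y] that eventually_happens by force
  have eq: "{x. fstar t < f x \<and> f x < fstar t'} = (\<Union>n. {x. fstar t < f x \<and> f x < r n})"
    using ex r by (auto intro: less_trans)
  have inc: "incseq (\<lambda>n. {x. fstar t < f x \<and> f x < r n})"
    using \<open>incseq r\<close> unfolding incseq_def by (auto intro: less_le_trans)
  have "emeasure M {x. fstar t < f x \<and> f x < r n} \<le> ennreal (t - t')" for n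
  proof -
    have fin: "emeasure M {x. r n < f x} \<noteq> top"
    proof -
      have "emeasure M {x. r n < f x} \<le> emeasure M {x. fstar t < f x}"
        using r(1)[of n] by (intro emeasure_mono) auto
      also have "\<dots> \<le> ennreal t" by (rule superlevel_fstar_le)
      finally show ?thesis by (auto simp: top_unique)
    qed
    have "ennreal t' < emeasure M {x. r n < f x}"
      using less_fstar_iff[of "r n" t'] r[of n] fstar_nonneg[of t] by auto
    have "emeasure M {x. fstar t < f x \<and> f x < r n} \<le> emeasure M ({x. fstar t < f x} - {x. r n < f x})"
      by (intro emeasure_mono) auto
    also have "\<dots> = emeasure M {x. fstar t < f x} - emeasure M {x. r n < f x}"
      using r(1)[of n] fin by (intro emeasure_Diff) auto
    also have "\<dots> \<le> ennreal t - ennreal t'"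
      using superlevel_fstar_le[of t] \<open>ennreal t' < _\<close> by (intro ennreal_minus_mono) auto
    also have "\<dots> = ennreal (t - t')" using t by (intro ennreal_minus) auto
    finally show ?thesis .
  qed
  then have "(SUP n. emeasure M {x. fstar t < f x \<and> f x < r n}) \<le> ennreal (t - t')"
    by (intro SUP_least)
  then show ?thesis
    unfolding eq by (subst SUP_emeasure_incseq[symmetric]) (use inc in auto)
qed

lemma slab_distribution:
  "distribution_fun M (slab t' t) l =
    emeasure M ({x. l < ennreal (gradient_modulus f x)} \<inter> {x. fstar t < f x \<and> f x < fstar t'})"
  unfolding distribution_fun_def slab_def
  by (intro arg_cong[where f="emeasure M"]) (auto simp: indicator_def split: if_splits)

lemma slab_distribution_0:
  assumes t: "0 < t'" "t' \<le> t"
  shows "distribution_fun M (slab t' t) l \<le> ennreal (t - t')"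
proof -
  have "distribution_fun M (slab t' t) l \<le> emeasure M {x. fstar t < f x \<and> f x < fstar t'}"
    unfolding slab_distribution by (intro emeasure_mono) auto
  also have "\<dots> \<le> ennreal (t - t')" by (rule slab_support[OF t])
  finally show ?thesis .
qed

text \<open>The coarea bound controls \<open>I(t')\<close> times the drop of \<open>fstar\<close> by
  the integral of the gradient over the slab, which equals that of the rearranged slab moved to
  \<open>(t', t)\<close>. There \<open>I(s) \<le> I(t)\<close>, so a factor
  \<open>I(t) / I(s)\<close> may be inserted, and \<open>I(t) \<le> 2 I(t')\<close> cancels the
  profile at \<open>t'\<close>.\<close>

lemma fstar_diff_le:
  assumes t: "0 < t'" "t' < t" "t \<le> m" "t \<le> 2 * t'"
  shows "ennreal (fstar t' - fstar t) \<le>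
    2 * (\<integral>\<^sup>+s\<in>{t'<..<t}. rearrangement M (slab t' t) (s - t') / ennreal (profile M s) \<partial>lborel)"
    (is "_ \<le> 2 * ?J")
proof (cases "fstar t < fstar t'")
  case False
  then show ?thesis by (simp add: ennreal_neg)
next
  case True
  have half: "ennreal s \<le> emeasure M (space M) / 2" if "s \<le> m" for s
    using m(2) ennreal_leI[OF that] by (rule order_trans[rotated])
  have pos: "0 < profile M s" if "0 < s" "s \<le> m" for s
    using that by (intro profile_pos[OF prof] m_in_dom) auto
  have fin: "emeasure M {x. fstar t < f x} < \<infinity>"
    using superlevel_fstar_le[of t] by (metis ennreal_less_top infinity_ennreal_def le_less_trans)
  \<comment> \<open>The quotient \<open>s / I(s)\<close> is non-decreasing and
    \<open>t \<le> 2 * t'\<close>; this is the origin of the factor 2.\<close>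
  have "profile M t \<le> 2 * profile M t'"
  proof -
    have "t' / profile M t' \<le> t / profile M t"
      using t by (intro profile_quotient_mono[OF prof] m_in_dom) auto
    then have "t' * profile M t \<le> t * profile M t'"
      using pos[of t] pos[of t'] t by (simp add: field_simps)
    also have "\<dots> \<le> (2 * t') * profile M t'"
      using t pos[of t'] by (intro mult_right_mono) auto
    finally show ?thesis using t by simp
  qed
  then have I2: "ennreal (profile M t) \<le> 2 * ennreal (profile M t')"
    by (metis ennreal_leI ennreal_mult' ennreal_numeral zero_le_numeral)
  have "ennreal (profile M t' * (fstar t' - fstar t)) \<le>
      (\<integral>\<^sup>+x\<in>{x. fstar t < f x \<and> f x < fstar t'}. ennreal (gradient_modulus f x) \<partial>M)"
    using t pos[of t']
    by (intro coarea_lower_bound[OF sets_M L True fin] profile_le_minkowski_content[of t' t]) auto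
  also have "\<dots> = (\<integral>\<^sup>+x. slab t' t x \<partial>M)" unfolding slab_def ..
  also have "\<dots> = (\<integral>\<^sup>+s\<in>{0<..<t - t'}. rearrangement M (slab t' t) s \<partial>lborel)"
    using slab_distribution_0 t by (intro nn_integral_rearrangement[symmetric]) auto
  also have "\<dots> = (\<integral>\<^sup>+s\<in>{t'<..<t}. rearrangement M (slab t' t) (s - t') \<partial>lborel)"
    using nn_integral_shift_interval[of "rearrangement M (slab t' t)" t' "t - t'"] by simp
  also have "\<dots> \<le> (\<integral>\<^sup>+s. ennreal (profile M t) * (rearrangement M (slab t' t) (s - t') / ennreal (profile M s) * indicator {t'<..<t} s) \<partial>lborel)"
  proof (intro nn_integral_mono)
    fix s :: real
    show "rearrangement M (slab t' t) (s - t') * indicator {t'<..<t} s \<le>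
      ennreal (profile M t) * (rearrangement M (slab t' t) (s - t') / ennreal (profile M s) * indicator {t'<..<t} s)"
    proof (cases "s \<in> {t'<..<t}")
      case True
      then have ps: "0 < profile M s" "profile M s \<le> profile M t"
        using t by (auto intro!: pos profile_mono_below_half[OF prof] half)
      have "rearrangement M (slab t' t) (s - t') = rearrangement M (slab t' t) (s - t') * (ennreal (profile M s) / ennreal (profile M s))"
        using ps by (subst ennreal_divide_self) auto
      also have "\<dots> \<le> rearrangement M (slab t' t) (s - t') * (ennreal (profile M t) / ennreal (profile M s))"
        using ps by (intro mult_left_mono divide_right_mono_ennreal ennreal_leI) auto
      also have "\<dots> = ennreal (profile M t) * (rearrangement M (slab t' t) (s - t') / ennreal (profile M s))"
        by (simp add: divide_ennreal_def mult_ac)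
      finally show ?thesis using True by simp
    qed simp
  qed
  also have "\<dots> = ennreal (profile M t) * (\<integral>\<^sup>+s. rearrangement M (slab t' t) (s - t') / ennreal (profile M s) * indicator {t'<..<t} s \<partial>lborel)"
  proof (rule nn_integral_cmult)
    \<comment> \<open>Continuity of the profile is available only on its domain; the indicator makes
      it Borel on the line without changing the integrand.\<close>
    have "{t'<..<t} \<subseteq> profile_dom M" using t by (auto intro: m_in_dom)
    then have "continuous_on {t'<..<t} (profile M)"
      using prof continuous_on_subset unfolding profile_conditions_def by blast
    then have "(\<lambda>s. indicator {t'<..<t} s *\<^sub>R profile M s) \<in> borel_measurable borel"
      by (intro borel_measurable_continuous_on_indicator) auto
    then have [measurable]: "(\<lambda>s. indicator {t'<..<t} s * profile M s) \<in> borel_measurable borel"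
      by simp
    have "(\<lambda>s. rearrangement M (slab t' t) (s - t') / ennreal (profile M s) * indicator {t'<..<t} s) =
      (\<lambda>s. rearrangement M (slab t' t) (s - t') / ennreal (indicator {t'<..<t} s * profile M s) * indicator {t'<..<t} s)"
      by (auto simp: indicator_def fun_eq_iff)
    then show "(\<lambda>s. rearrangement M (slab t' t) (s - t') / ennreal (profile M s) * indicator {t'<..<t} s) \<in> borel_measurable lborel"
      by simp
  qed
  also have "\<dots> \<le> 2 * ennreal (profile M t') * ?J"
    using I2 by (intro mult_right_mono) auto
  finally have "ennreal (profile M t') * ennreal (fstar t' - fstar t) \<le> ennreal (profile M t') * (2 * ?J)"
    using pos[of t'] t True by (simp add: ennreal_mult mult_ac)
  then show ?thesis
    using pos[of t'] t by (subst (asm) ennreal_mult_le_mult_iff) auto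
qed

section \<open>Discretization on an equidistant grid and passage to the limit\<close>

text \<open>The slab belonging to a cell of length \<open>\<delta>\<close> has measure at most \<open>\<delta>\<close>, so the concatenated
  rearrangements are dominated in distribution by the gradient. The cell at \<open>0\<close> is left out because
  \<open>fstar_diff_le\<close> needs \<open>t \<le> 2 t'\<close>.\<close>

definition grid_cell :: "real \<Rightarrow> nat \<Rightarrow> real \<Rightarrow> ennreal" where
  "grid_cell \<delta> k s = rearrangement M (slab (real k * \<delta>) (real (Suc k) * \<delta>)) (s - real k * \<delta>) * indicator {real k * \<delta><..<real (Suc k) * \<delta>} s"

text \<open>Real-valued because the Hardy operator acts on real functions. The conversion loses
  nothing: every cell is bounded by the Lipschitz constant.\<close>

definition grid_gradient :: "real \<Rightarrow> nat \<Rightarrow> real \<Rightarrow> real" where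
  "grid_gradient \<delta> n s = enn2real (\<Sum>k\<in>{1..<n}. grid_cell \<delta> k s)"

lemma borel_measurable_grid_cell [measurable]: "grid_cell \<delta> k \<in> borel_measurable borel"
  unfolding grid_cell_def[abs_def] by measurable

lemma borel_measurable_grid_gradient [measurable]: "grid_gradient \<delta> n \<in> borel_measurable borel"
  unfolding grid_gradient_def[abs_def] by measurable

lemma rearrangement_slab_le: "rearrangement M (slab t' t) s \<le> ennreal L"
proof -
  have "distribution_fun M (slab t' t) (ennreal L) = 0"
  proof -
    have e: "{x. ennreal L < ennreal (gradient_modulus f x)} = {}"
      using gradient_modulus_le_lipschitz[OF L] ennreal_leI by (auto simp: not_less)
    show ?thesis unfolding slab_distribution e by simp
  qed
  then have "\<not> ennreal L < rearrangement M (slab t' t) s"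
    by (subst less_rearrangement_iff) auto
  then show ?thesis by simp
qed

lemma grid_cell_less_top: "grid_cell \<delta> k s < top"
  unfolding grid_cell_def
  using le_less_trans[OF rearrangement_slab_le ennreal_less_top] by (simp add: indicator_def)

lemma ennreal_grid_gradient: "ennreal (grid_gradient \<delta> n s) = (\<Sum>k\<in>{1..<n}. grid_cell \<delta> k s)"
  unfolding grid_gradient_def using grid_cell_less_top by (intro ennreal_enn2real) simp

lemma grid_gradient_nonneg [simp]: "0 \<le> grid_gradient \<delta> n s"
  unfolding grid_gradient_def by simp

lemma grid_cells_disjoint:
  assumes "0 < \<delta>" "s \<in> {real j * \<delta><..<real (Suc j) * \<delta>}" "s \<in> {real k * \<delta><..<real (Suc k) * \<delta>}"
  shows "j = k"
proof -
  have "real j * \<delta> < real (Suc k) * \<delta>" "real k * \<delta> < real (Suc j) * \<delta>"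
    using assms(2,3) unfolding greaterThanLessThan_iff by linarith+
  then have "real j < real (Suc k)" "real k < real (Suc j)"
    unfolding mult_less_cancel_right_pos[OF assms(1)] by blast+
  then show ?thesis by linarith
qed

text \<open>At most one cell is nonzero at a given \<open>s\<close>, so the superlevel set is
  covered by translated initial intervals, one per cell, each as long as the slab's distribution
  function at \<open>l\<close>. Subadditivity suffices on the line; on the space the slabs are
  disjoint, so their measures add up inside the superlevel set of the gradient.\<close>

lemma grid_gradient_distribution:
  assumes \<delta>: "0 < \<delta>"
  shows "distribution_fun (interval_measure_space M) (\<lambda>s. ennreal (grid_gradient \<delta> n s)) l \<le>
    distribution_fun M (\<lambda>x. ennreal (gradient_modulus f x)) l"
proof -
  let ?C = "\<lambda>k::nat. {s. real k * \<delta> < s \<and> ennreal (s - real k * \<delta>) < distribution_fun M (slab (real k * \<delta>) (real (Suc k) * \<delta>)) l}"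
  let ?G = "\<lambda>k::nat. {x. l < ennreal (gradient_modulus f x)} \<inter> {x. fstar (real (Suc k) * \<delta>) < f x \<and> f x < fstar (real k * \<delta>)}"
  let ?A = "{s \<in> space (interval_measure_space M). l < ennreal (grid_gradient \<delta> n s)}"
  have C [measurable]: "?C k \<in> sets borel" for k by measurable
  have sub: "?A \<subseteq> (\<Union>k\<in>{1..<n}. ?C k)"
  proof
    fix s assume "s \<in> ?A"
    then have l: "l < (\<Sum>k\<in>{1..<n}. grid_cell \<delta> k s)" by (simp add: ennreal_grid_gradient)
    then have "(\<Sum>k\<in>{1..<n}. grid_cell \<delta> k s) \<noteq> 0" by (metis not_less_zero)
    then obtain k where k: "k \<in> {1..<n}" "grid_cell \<delta> k s \<noteq> 0"
      by (rule sum.not_neutral_contains_not_neutral)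
    then have s: "s \<in> {real k * \<delta><..<real (Suc k) * \<delta>}" unfolding grid_cell_def by (auto simp: indicator_def split: if_splits)
    have "grid_cell \<delta> j s = 0" if "j \<noteq> k" for j
      using grid_cells_disjoint[OF \<delta> _ s, of j] that unfolding grid_cell_def by (auto simp: indicator_def)
    then have "(\<Sum>k\<in>{1..<n}. grid_cell \<delta> k s) = grid_cell \<delta> k s"
      using k by (subst sum.remove[of _ k]) auto
    then have "l < rearrangement M (slab (real k * \<delta>) (real (Suc k) * \<delta>)) (s - real k * \<delta>)"
      using l s by (simp add: grid_cell_def)
    then show "s \<in> (\<Union>k\<in>{1..<n}. ?C k)"
      using k s less_rearrangement_iff[OF borel_measurable_slab, of l] by auto
  qed
  have "distribution_fun (interval_measure_space M) (\<lambda>s. ennreal (grid_gradient \<delta> n s)) l = emeasure (interval_measure_space M) ?A"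
    unfolding distribution_fun_def ..
  also have "\<dots> = emeasure lborel ?A"
  proof (rule emeasure_interval_measure_space)
    have "?A = {t. 0 < t \<and> ennreal t < emeasure M (space M)} \<inter> {s \<in> space borel. l < ennreal (grid_gradient \<delta> n s)}"
      by (auto simp: space_interval_measure_space)
    then show "?A \<in> sets borel" by simp
  qed (auto simp: space_interval_measure_space)
  also have "\<dots> \<le> emeasure lborel (\<Union>k\<in>{1..<n}. ?C k)"
    by (intro emeasure_mono sub) auto
  also have "\<dots> \<le> (\<Sum>k\<in>{1..<n}. emeasure lborel (?C k))"
    by (intro emeasure_subadditive_finite) auto
  also have "\<dots> = (\<Sum>k\<in>{1..<n}. emeasure M (?G k))"
    by (simp add: emeasure_shifted_initial_interval slab_distribution)
  also have "\<dots> = emeasure M (\<Union>k\<in>{1..<n}. ?G k)"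
  proof (rule sum_emeasure)
    have "{x. l < ennreal (gradient_modulus f x)} \<in> sets M" by (rule Collect_in_sets_M) measurable
    then show "?G ` {1..<n} \<subseteq> sets M" by auto
    show "disjoint_family_on ?G {1..<n}"
      unfolding disjoint_family_on_def
    proof (intro ballI impI)
      fix j k :: nat assume "j \<noteq> k"
      have disj: "?G j \<inter> ?G k = {}" if "j < k" for j k
      proof -
        have "real (Suc j) * \<delta> \<le> real k * \<delta>" using that \<delta> by (intro mult_right_mono) auto
        then have "fstar (real k * \<delta>) \<le> fstar (real (Suc j) * \<delta>)" by (rule fstar_antimono)
        then show ?thesis by auto
      qed
      show "?G j \<inter> ?G k = {}"
      proof (cases "j < k")
        case True
        then show ?thesis by (rule disj)
      next
        case False
        with \<open>j \<noteq> k\<close> have "k < j" by simp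
        then show ?thesis by (subst Int_commute) (rule disj)
      qed
    qed
  qed simp
  also have "\<dots> \<le> distribution_fun M (\<lambda>x. ennreal (gradient_modulus f x)) l"
    unfolding distribution_fun_def by (intro emeasure_mono) auto
  finally show ?thesis .
qed

lemma norm_grid_gradient_le:
  assumes \<delta>: "0 < \<delta>"
  shows "norm_in \<sigma> (grid_gradient \<delta> n) \<le> norm_in \<rho> (gradient_modulus f)"
proof -
  have "\<sigma> (\<lambda>s. ennreal (grid_gradient \<delta> n s)) \<le> \<rho> (\<lambda>x. ennreal (gradient_modulus f x))"
    by (intro ri_norm_le_of_distribution_le[OF rep] borel_measurable_interval grid_gradient_distribution[OF \<delta>]) auto
  then show ?thesis unfolding norm_in_def by (simp add: gradient_modulus_nonneg)
qed

lemma borel_measurable_profile_below_m: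
  "(\<lambda>s. indicator {0<..<m} s * profile M s) \<in> borel_measurable borel"
proof -
  have "{0<..<m} \<subseteq> profile_dom M" by (auto intro: m_in_dom)
  then have "continuous_on {0<..<m} (profile M)"
    using prof continuous_on_subset unfolding profile_conditions_def by blast
  then have "(\<lambda>s. indicator {0<..<m} s *\<^sub>R profile M s) \<in> borel_measurable borel"
    by (intro borel_measurable_continuous_on_indicator) auto
  then show ?thesis by simp
qed

text \<open>Telescoping of \<open>fstar\<close> from the first grid point beyond \<open>t\<close> up
  to \<open>m\<close>, where it vanishes. The shift by \<delta> on the left absorbs the distance
  from \<open>t\<close> to that grid point.\<close>

lemma fstar_le_grid_integral:
  assumes n: "0 < n" and \<delta>: "\<delta> = m / n" and t: "0 < t" "t < m"
  shows "ennreal (fstar (t + \<delta>)) \<le> 2 * (\<integral>\<^sup>+s\<in>{t<..<m}. ennreal (grid_gradient \<delta> n s) / ennreal (profile M s) \<partial>lborel)"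
proof -
  have \<delta>0: "0 < \<delta>" using n m \<delta> by simp
  have n\<delta>: "real n * \<delta> = m" using n \<delta> by simp
  \<comment> \<open>Index of the first grid point strictly beyond \<open>t\<close>. It is at least
    1, so the omitted cell at 0 never occurs in the sum.\<close>
  define i where "i = nat \<lfloor>t / \<delta>\<rfloor> + 1"
  have "real (nat \<lfloor>t / \<delta>\<rfloor>) = of_int \<lfloor>t / \<delta>\<rfloor>" using t \<delta>0 by simp
  then have "t / \<delta> < real i" "real i \<le> t / \<delta> + 1"
    unfolding i_def by linarith+
  then have i: "t < real i * \<delta>" "real i * \<delta> \<le> t + \<delta>" "1 \<le> i"
    using \<delta>0 by (auto simp: field_simps i_def)
  have le: "fstar (t + \<delta>) \<le> fstar (real i * \<delta>)" using i by (intro fstar_antimono)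
  show ?thesis
  proof (cases "i < n")
    case False
    then have "m \<le> real i * \<delta>" using \<delta>0 unfolding n\<delta>[symmetric] by (intro mult_right_mono) auto
    then have "fstar (t + \<delta>) = 0" using i by (intro fstar_eq_0) simp
    then show ?thesis by simp
  next
    case True
    have "(\<Sum>k=i..<n. fstar (real k * \<delta>) - fstar (real (Suc k) * \<delta>)) = - (\<Sum>k=i..<n. fstar (real (Suc k) * \<delta>) - fstar (real k * \<delta>))"
      by (simp flip: sum_negf)
    also have "\<dots> = fstar (real i * \<delta>) - fstar (real n * \<delta>)"
      using True sum_Suc_diff'[of i n "\<lambda>k. fstar (real k * \<delta>)"] by simp
    finally have tel: "fstar (real i * \<delta>) = (\<Sum>k=i..<n. fstar (real k * \<delta>) - fstar (real (Suc k) * \<delta>))"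
      unfolding n\<delta> using fstar_eq_0[of m] by simp
    have step: "real k * \<delta> \<le> real (Suc k) * \<delta>" for k using \<delta>0 by (intro mult_right_mono) auto
    have "ennreal (fstar (t + \<delta>)) \<le> ennreal (\<Sum>k=i..<n. fstar (real k * \<delta>) - fstar (real (Suc k) * \<delta>))"
      using le unfolding tel by (rule ennreal_leI)
    also have "\<dots> = (\<Sum>k=i..<n. ennreal (fstar (real k * \<delta>) - fstar (real (Suc k) * \<delta>)))"
      using fstar_antimono[OF step] by (intro sum_ennreal[symmetric]) auto
    also have "\<dots> \<le> (\<Sum>k=i..<n. 2 * (\<integral>\<^sup>+s. grid_cell \<delta> k s / ennreal (indicator {0<..<m} s * profile M s) \<partial>lborel))"
    proof (rule sum_mono)
      fix k assume k: "k \<in> {i..<n}"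
      \<comment> \<open>From \<open>k \<ge> 1\<close> follows
        \<open>real (Suc k) * \<delta> \<le> 2 * (real k * \<delta>)\<close>, the doubling condition
        of \<open>fstar_diff_le\<close>.\<close>
      have "1 * \<delta> \<le> real k * \<delta>" "real (Suc k) * \<delta> \<le> real n * \<delta>"
        using k i \<delta>0 by (auto intro!: mult_right_mono simp del: of_nat_Suc)
      then have k': "\<delta> \<le> real k * \<delta>" "real (Suc k) * \<delta> \<le> m" unfolding n\<delta> by auto
      then have "real (Suc k) * \<delta> \<le> 2 * (real k * \<delta>)" by (simp add: algebra_simps)
      have "0 < real k * \<delta>" using k' \<delta>0 by linarith
      have "ennreal (fstar (real k * \<delta>) - fstar (real (Suc k) * \<delta>)) \<le>
        2 * (\<integral>\<^sup>+s\<in>{real k * \<delta><..<real (Suc k) * \<delta>}. rearrangement M (slab (real k * \<delta>) (real (Suc k) * \<delta>)) (s - real k * \<delta>) / ennreal (profile M s) \<partial>lborel)"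
        using \<open>0 < real k * \<delta>\<close> k' \<open>_ \<le> 2 * _\<close> \<delta>0 by (intro fstar_diff_le) (auto simp: algebra_simps)
      also have "(\<integral>\<^sup>+s\<in>{real k * \<delta><..<real (Suc k) * \<delta>}. rearrangement M (slab (real k * \<delta>) (real (Suc k) * \<delta>)) (s - real k * \<delta>) / ennreal (profile M s) \<partial>lborel)
        = (\<integral>\<^sup>+s. grid_cell \<delta> k s / ennreal (indicator {0<..<m} s * profile M s) \<partial>lborel)"
        using \<open>0 < real k * \<delta>\<close> k'(2) by (intro nn_integral_cong) (auto simp: grid_cell_def indicator_def)
      finally show "ennreal (fstar (real k * \<delta>) - fstar (real (Suc k) * \<delta>)) \<le>
        2 * (\<integral>\<^sup>+s. grid_cell \<delta> k s / ennreal (indicator {0<..<m} s * profile M s) \<partial>lborel)" .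
    qed
    also have "\<dots> = 2 * (\<integral>\<^sup>+s. (\<Sum>k=i..<n. grid_cell \<delta> k s / ennreal (indicator {0<..<m} s * profile M s)) \<partial>lborel)"
      using borel_measurable_profile_below_m by (subst nn_integral_sum) (auto simp: sum_distrib_left)
    also have "\<dots> \<le> 2 * (\<integral>\<^sup>+s\<in>{t<..<m}. ennreal (grid_gradient \<delta> n s) / ennreal (profile M s) \<partial>lborel)"
    proof (intro mult_left_mono nn_integral_mono)
      fix s :: real
      show "(\<Sum>k=i..<n. grid_cell \<delta> k s / ennreal (indicator {0<..<m} s * profile M s))
        \<le> ennreal (grid_gradient \<delta> n s) / ennreal (profile M s) * indicator {t<..<m} s"
      proof (cases "s \<in> {t<..<m}")
        case True
        have "(\<Sum>k=i..<n. grid_cell \<delta> k s / ennreal (indicator {0<..<m} s * profile M s)) = (\<Sum>k=i..<n. grid_cell \<delta> k s) / ennreal (profile M s)"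
          using True t by (simp add: divide_ennreal_def sum_distrib_right)
        also have "(\<Sum>k=i..<n. grid_cell \<delta> k s) \<le> (\<Sum>k\<in>{1..<n}. grid_cell \<delta> k s)"
          using i by (intro sum_mono2) auto
        finally show ?thesis
          using True by (simp add: ennreal_grid_gradient divide_right_mono_ennreal)
      next
        case False
        have "grid_cell \<delta> k s = 0" if "k \<in> {i..<n}" for k
        proof -
          have "real i * \<delta> \<le> real k * \<delta>" "real (Suc k) * \<delta> \<le> real n * \<delta>"
            using that \<delta>0 by (auto intro!: mult_right_mono simp del: of_nat_Suc)
          then have "s \<notin> {real k * \<delta><..<real (Suc k) * \<delta>}" using False i(1) unfolding n\<delta> by auto
          then show ?thesis by (simp add: grid_cell_def)
        qed
        then show ?thesis by simp
      qed
    qed simp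
    finally show ?thesis .
  qed
qed

text \<open>Enlarging \<open>(t, m)\<close> to the whole Hardy range only increases the integral of
  a nonnegative function, and the finite norm of the grid function guarantees convergence. The
  factor \<open>t / I(t)\<close> undoes the factor \<open>I(t) / t\<close> of the operator.\<close>

lemma fstar_le_hardy:
  assumes n: "0 < n" and \<delta>: "\<delta> = m / n" and t: "0 < t" "t < m"
    and fin: "norm_in \<rho> (gradient_modulus f) < \<infinity>"
  shows "fstar (t + \<delta>) \<le> 2 * (t / profile M t) * isoperimetric_hardy M (grid_gradient \<delta> n) t"
proof -
  let ?h = "grid_gradient \<delta> n"
  have \<delta>0: "0 < \<delta>" using n m \<delta> by simp
  have inR: "s \<in> hardy_range M 0" if "0 < s" "s < m" for s
    using that m(2) less_le_trans[of "ennreal s" "ennreal m"] unfolding hardy_range_def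
    by (auto simp: ennreal_less_iff)
  have pos: "0 < profile M s" if "s \<in> hardy_range M 0" for s
    using that hardy_range_subset_profile_dom[of M]
    by (intro profile_pos[OF prof]) (blast, simp add: hardy_range_def)
  have "norm_in \<sigma> ?h < \<infinity>"
    using norm_grid_gradient_le[OF \<delta>0] fin by (rule le_less_trans)
  then have int: "set_integrable lborel (hardy_range M t) (\<lambda>s. ?h s / profile M s)"
    using hardy[OF borel_measurable_interval[OF borel_measurable_grid_gradient]] inR[OF t] by blast
  have sub: "hardy_range M t \<subseteq> hardy_range M 0" using t unfolding hardy_range_def by auto
  have "ennreal (fstar (t + \<delta>)) \<le> 2 * (\<integral>\<^sup>+s\<in>{t<..<m}. ennreal (?h s) / ennreal (profile M s) \<partial>lborel)"
    by (rule fstar_le_grid_integral[OF n \<delta> t])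
  also have "\<dots> \<le> 2 * (\<integral>\<^sup>+s. ennreal (indicator (hardy_range M t) s *\<^sub>R (?h s / profile M s)) \<partial>lborel)"
  proof (intro mult_left_mono nn_integral_mono)
    fix s
    show "ennreal (?h s) / ennreal (profile M s) * indicator {t<..<m} s \<le> ennreal (indicator (hardy_range M t) s *\<^sub>R (?h s / profile M s))"
    proof (cases "s \<in> {t<..<m}")
      case True
      then have "s \<in> hardy_range M 0" using t by (intro inR) auto
      moreover from this have "s \<in> hardy_range M t" using True unfolding hardy_range_def by auto
      ultimately show ?thesis using True pos[of s] by (simp add: divide_ennreal)
    qed simp
  qed simp
  also have "(\<integral>\<^sup>+s. ennreal (indicator (hardy_range M t) s *\<^sub>R (?h s / profile M s)) \<partial>lborel) =
    ennreal (LINT s:hardy_range M t|lborel. ?h s / profile M s)"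
    unfolding set_lebesgue_integral_def
  proof (rule nn_integral_eq_integral)
    show "integrable lborel (\<lambda>s. indicator (hardy_range M t) s *\<^sub>R (?h s / profile M s))"
      using int unfolding set_integrable_def .
    have "0 \<le> indicator (hardy_range M t) s *\<^sub>R (?h s / profile M s)" for s
      using pos[of s] sub by (auto simp: indicator_def intro!: divide_nonneg_pos)
    then show "AE s in lborel. 0 \<le> indicator (hardy_range M t) s *\<^sub>R (?h s / profile M s)" by simp
  qed
  finally have "ennreal (fstar (t + \<delta>)) \<le> ennreal (2 * (LINT s:hardy_range M t|lborel. ?h s / profile M s))"
    by (simp add: ennreal_mult')
  moreover have "0 \<le> (LINT s:hardy_range M t|lborel. ?h s / profile M s)"
    unfolding set_lebesgue_integral_def using pos sub
    by (intro Bochner_Integration.integral_nonneg) (auto simp: indicator_def intro!: divide_nonneg_pos)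
  ultimately have "fstar (t + \<delta>) \<le> 2 * (LINT s:hardy_range M t|lborel. ?h s / profile M s)"
    by (simp add: ennreal_le_iff)
  also have "\<dots> = 2 * (t / profile M t) * isoperimetric_hardy M ?h t"
    using inR[OF t] pos[OF inR[OF t]] t unfolding isoperimetric_hardy_def by simp
  finally show ?thesis .
qed

text \<open>The rearrangement of \<open>f\<close> restricted to \<open>W\<close> is below
  \<open>fstar\<close> and vanishes from the measure of \<open>W\<close> on, so the quotient bound
  is needed only for smaller \<open>t\<close>. The Hardy estimate controls its translates by mesh
  sizes, uniformly in the mesh, and these increase to it.\<close>

lemma norm_positive_part_le:
  assumes W: "W \<in> sets M" and \<kappa>: "0 \<le> \<kappa>"
    and quot: "\<And>t. 0 < t \<Longrightarrow> t < m \<Longrightarrow> ennreal t < emeasure M W \<Longrightarrow> t / profile M t \<le> \<kappa>"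
    and fin: "norm_in \<rho> (gradient_modulus f) < \<infinity>"
  shows "\<rho> (\<lambda>x. ennreal (f x) * indicator W x) \<le> ennreal (2 * \<kappa> * B) * norm_in \<rho> (gradient_modulus f)"
proof -
  note [measurable] = W
  let ?u = "\<lambda>x. ennreal (f x) * indicator W x"
  let ?R = "rearrangement M ?u"
  define \<delta> where "\<delta> n = m / Suc n" for n
  have \<delta>0: "0 < \<delta> n" for n using m by (simp add: \<delta>_def)
  have le_f: "?R t \<le> ennreal (fstar t)" for t
  proof -
    have "distribution_fun M ?u l \<le> distribution_fun M (\<lambda>x. ennreal (f x)) l" for l
      unfolding distribution_fun_def by (intro emeasure_mono) (auto simp: indicator_def split: if_splits)
    then show ?thesis
      unfolding ennreal_fstar rearrangement_def by (intro Inf_superset_mono) (use order_trans in blast)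
  qed
  have zero: "?R t = 0" if "emeasure M W \<le> ennreal t" for t
  proof -
    have "distribution_fun M ?u 0 \<le> emeasure M W"
      unfolding distribution_fun_def by (intro emeasure_mono) (auto simp: indicator_def split: if_splits)
    then have "\<not> 0 < ?R t"
      using that by (subst less_rearrangement_iff) (auto simp: not_less intro: order_trans)
    then show ?thesis by simp
  qed
  \<comment> \<open>The translate compensates the shift by \<delta> in
    \<open>fstar_le_hardy\<close>.\<close>
  define S where "S n t = ?R (t + \<delta> n)" for n t
  have S_meas: "S n \<in> borel_measurable borel" for n
    unfolding S_def[abs_def] by measurable
  have S_le: "S n t \<le> ennreal (2 * \<kappa>) * ennreal \<bar>isoperimetric_hardy M (grid_gradient (\<delta> n) (Suc n)) t\<bar>" if t: "0 < t" for n t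
  proof (cases "t < m \<and> ennreal t < emeasure M W")
    case True
    let ?Q = "isoperimetric_hardy M (grid_gradient (\<delta> n) (Suc n)) t"
    have "S n t \<le> ennreal (fstar (t + \<delta> n))" unfolding S_def by (rule le_f)
    also have "\<dots> \<le> ennreal (2 * (t / profile M t) * ?Q)"
      using t True fin by (intro ennreal_leI fstar_le_hardy) (auto simp: \<delta>_def)
    also have "\<dots> \<le> ennreal (2 * \<kappa> * \<bar>?Q\<bar>)"
    proof (rule ennreal_leI)
      have "0 < profile M t" using t True by (intro profile_pos[OF prof] m_in_dom) auto
      then have "2 * (t / profile M t) * ?Q \<le> 2 * (t / profile M t) * \<bar>?Q\<bar>"
        using t by (intro mult_left_mono) auto
      also have "\<dots> \<le> 2 * \<kappa> * \<bar>?Q\<bar>"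
        using t True by (intro mult_right_mono mult_left_mono quot) auto
      finally show "2 * (t / profile M t) * ?Q \<le> 2 * \<kappa> * \<bar>?Q\<bar>" .
    qed
    also have "\<dots> = ennreal (2 * \<kappa>) * ennreal \<bar>?Q\<bar>" using \<kappa> by (simp add: ennreal_mult)
    finally show ?thesis .
  next
    case False
    have "S n t = 0"
    proof (cases "t < m")
      case True
      then have "emeasure M W \<le> ennreal t" using False by auto
      also have "\<dots> \<le> ennreal (t + \<delta> n)" using \<delta>0[of n] by (intro ennreal_leI) simp
      finally show ?thesis unfolding S_def by (rule zero)
    next
      case False
      then have "fstar (t + \<delta> n) = 0" using \<delta>0[of n] by (intro fstar_eq_0) simp
      then show ?thesis using le_f[of "t + \<delta> n"] unfolding S_def by simp
    qed
    then show ?thesis by simp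
  qed
  have S_norm: "\<sigma> (S n) \<le> ennreal (2 * \<kappa> * B) * norm_in \<rho> (gradient_modulus f)" for n
  proof -
    let ?h = "grid_gradient (\<delta> n) (Suc n)"
    have Qm: "(\<lambda>t. ennreal \<bar>isoperimetric_hardy M ?h t\<bar>) \<in> borel_measurable (interval_measure_space M)"
      using borel_measurable_isoperimetric_hardy[OF prof, of ?h] by (intro borel_measurable_interval) simp
    have hn: "norm_in \<sigma> ?h \<le> norm_in \<rho> (gradient_modulus f)" by (rule norm_grid_gradient_le[OF \<delta>0])
    have "\<sigma> (S n) \<le> \<sigma> (\<lambda>t. ennreal (2 * \<kappa>) * ennreal \<bar>isoperimetric_hardy M ?h t\<bar>)"
      using S_le Qm S_meas by (intro \<sigma>_mono) (auto intro: borel_measurable_interval)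
    also have "\<dots> = ennreal (2 * \<kappa>) * norm_in \<sigma> (isoperimetric_hardy M ?h)"
      unfolding norm_in_def using \<kappa> by (intro \<sigma>_scale Qm) simp
    also have "\<dots> \<le> ennreal (2 * \<kappa>) * (ennreal B * norm_in \<sigma> ?h)"
      using hardy[OF borel_measurable_interval[OF borel_measurable_grid_gradient] le_less_trans[OF hn fin]]
      by (intro mult_left_mono) auto
    also have "\<dots> \<le> ennreal (2 * \<kappa>) * (ennreal B * norm_in \<rho> (gradient_modulus f))"
      using hn by (intro mult_left_mono) auto
    finally show ?thesis using \<kappa> B_nonneg by (simp add: ennreal_mult mult.assoc)
  qed
  have "\<rho> ?u = \<sigma> ?R"
    by (rule \<rho>_eq_\<sigma>) (auto simp: indicator_def)
  also have "\<dots> = (SUP n. \<sigma> (S n))"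
  proof (rule \<sigma>_Fatou)
    show "incseq (\<lambda>n. S n s)" for s
      unfolding S_def \<delta>_def using m by (intro incseq_SucI rearrangement_antimono) (simp add: frac_le)
    show "?R s = (SUP n. S n s)" for s
    proof (rule antisym)
      show "(SUP n. S n s) \<le> ?R s"
        unfolding S_def using \<delta>0 by (intro SUP_least rearrangement_antimono) (simp add: less_imp_le)
      \<comment> \<open>Right continuity of the rearrangement: \<open>y < ?R s\<close> is the strict
        condition \<open>ennreal s < distribution_fun M ?u y\<close>, which persists for slightly
        larger \<open>s\<close>.\<close>
      show "?R s \<le> (SUP n. S n s)"
        unfolding le_SUP_iff
      proof safe
        fix y assume "y < ?R s"
        then have "ennreal s < distribution_fun M ?u y" by (subst (asm) less_rearrangement_iff) auto
        moreover have "(\<lambda>n. ennreal (s + \<delta> n)) \<longlonglongrightarrow> ennreal (s + 0)"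
        proof -
          have "(\<lambda>n. m * (1 / Suc n)) \<longlonglongrightarrow> m * 0" by (intro tendsto_intros LIMSEQ_Suc[OF lim_1_over_n])
          then show ?thesis unfolding \<delta>_def by (intro tendsto_ennrealI tendsto_add tendsto_const) simp
        qed
        ultimately obtain n where "ennreal (s + \<delta> n) < distribution_fun M ?u y"
          using order_tendstoD(2)[of _ "ennreal (s + 0)" sequentially "distribution_fun M ?u y"] eventually_happens by force
        then have "y < S n s" unfolding S_def by (subst less_rearrangement_iff) auto
        then show "\<exists>n\<in>UNIV. y < S n s" by blast
      qed
    qed
  qed (auto intro!: borel_measurable_interval S_meas)
  also have "\<dots> \<le> ennreal (2 * \<kappa> * B) * norm_in \<rho> (gradient_modulus f)"
    by (intro SUP_least S_norm)
  finally show ?thesis .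
qed

end

section \<open>Consequences of the weight condition, and medians\<close>

lemma lip_uminus: "L-lipschitz_on UNIV (f :: 'a::metric_space \<Rightarrow> real) \<Longrightarrow> L-lipschitz_on UNIV (\<lambda>x. - f x)"
  by (simp add: lipschitz_on_def dist_real_def)

lemma lip_diff_const: "L-lipschitz_on UNIV (f :: 'a::metric_space \<Rightarrow> real) \<Longrightarrow> L-lipschitz_on UNIV (\<lambda>x. f x - c)"
  by (simp add: lipschitz_on_def dist_real_def)

text \<open>The weight condition controls the quotient at a single argument \<open>x\<close>;
  monotonicity extends this to all \<open>t\<close> up to \<open>x\<close>. For
  \<open>x = top\<close> the value is a limit at infinity, which by monotonicity is the supremum of
  all quotients.\<close>

lemma profile_quotient_bound:
  assumes prof: "profile_conditions M"
    and q: "profile_quotient M x \<le> ennreal c" "0 \<le> c"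
    and x: "x \<le> emeasure M (space M) / 2"
    and t: "0 < t" "ennreal t \<le> x"
  shows "t / profile M t \<le> c"
proof (cases x)
  case (real y)
  then have ty: "t \<le> y" using t by (simp add: ennreal_le_iff)
  have "y \<in> profile_dom M" using half_in_profile_dom[of y M] x t ty unfolding real by auto
  then have "t / profile M t \<le> y / profile M y"
    using t ty by (intro profile_quotient_mono[OF prof])
  moreover have "ennreal (y / profile M y) \<le> ennreal c"
    using q t ty unfolding profile_quotient_def real by (auto split: if_splits)
  ultimately show ?thesis using q(2) by (simp add: ennreal_le_iff)
next
  case top
  then have "emeasure M (space M) = top"
    using x by (metis ennreal_divide_eq_top_iff top.extremum_unique top_neq_numeral zero_neq_numeral)
  then have dom: "s \<in> profile_dom M" if "0 < s" for s using that by (simp add: profile_dom_def)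
  let ?q = "\<lambda>s. ennreal (s / profile M s)"
  have "(?q \<longlongrightarrow> (SUP s\<in>{0<..}. ?q s)) at_top"
  proof (rule increasing_tendsto)
    show "\<forall>\<^sub>F s in at_top. ?q s \<le> (SUP s\<in>{0<..}. ?q s)"
      using eventually_gt_at_top[of 0] by eventually_elim (auto intro: SUP_upper)
    fix y assume "y < (SUP s\<in>{0<..}. ?q s)"
    then obtain s where s: "0 < s" "y < ?q s" by (auto simp: less_SUP_iff)
    show "\<forall>\<^sub>F s in at_top. y < ?q s"
      using eventually_ge_at_top[of s]
    proof eventually_elim
      case (elim s')
      have "?q s \<le> ?q s'" using s elim by (intro ennreal_leI profile_quotient_mono[OF prof] dom) auto
      with s(2) show ?case by (rule less_le_trans)
    qed
  qed
  then have "Lim at_top ?q = (SUP s\<in>{0<..}. ?q s)" by (intro tendsto_Lim) auto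
  then have "profile_quotient M x = (SUP s\<in>{0<..}. ?q s)"
    unfolding profile_quotient_def top by simp
  moreover have "?q t \<le> (SUP s\<in>{0<..}. ?q s)" using t by (intro SUP_upper) auto
  ultimately have "?q t \<le> ennreal c" using q by (metis order_trans)
  then show ?thesis using q(2) by (simp add: ennreal_le_iff)
qed

text \<open>Take \<open>c\<close> to be the infimum of the levels \<open>s\<close> for which
  \<open>{s < f}\<close> has at most half of the mass. Approaching \<open>c\<close> from above and
  from below, continuity of the measure gives the two bounds, stated in the form in which they bound
  the supports of both parts of \<open>f - c\<close>.\<close>

lemma (in finite_measure) ex_median:
  fixes f :: "'a \<Rightarrow> real"
  assumes [measurable]: "f \<in> borel_measurable M" and b: "\<And>x. \<bar>f x\<bar> \<le> b" and pos: "0 < measure M (space M)"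
  shows "\<exists>c. measure M {x \<in> space M. c < f x} \<le> measure M (space M) / 2 \<and>
    measure M {x \<in> space M. f x < c} \<le> measure M (space M) / 2"
proof -
  let ?m = "measure M (space M) / 2"
  define S where "S = {s. measure M {x \<in> space M. s < f x} \<le> ?m}"
  have "b \<in> S"
  proof -
    have "{x \<in> space M. b < f x} = {}" using b by (force simp: abs_le_iff not_less)
    then have "measure M {x \<in> space M. b < f x} = 0" by (simp only: measure_empty)
    then show ?thesis unfolding S_def using pos by simp
  qed
  have low: "- b - 1 \<le> s" if "s \<in> S" for s
  proof (rule ccontr)
    assume "\<not> - b - 1 \<le> s"
    then have "s < f x" for x using b[of x] by (simp add: abs_le_iff)
    then have "{x \<in> space M. s < f x} = space M" by auto
    then show False using that pos unfolding S_def by simp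
  qed
  have bdd: "bdd_below S" using low by (rule bdd_belowI)
  define c where "c = Inf S"
  have above: "measure M {x \<in> space M. s < f x} \<le> ?m" if "c < s" for s
  proof -
    obtain s' where s': "s' \<in> S" "s' < s"
      using cInf_lessD[of S s] \<open>c < s\<close> \<open>b \<in> S\<close> unfolding c_def by blast
    have "measure M {x \<in> space M. s < f x} \<le> measure M {x \<in> space M. s' < f x}"
      using s' by (intro finite_measure_mono) auto
    then show ?thesis using s'(1) unfolding S_def by simp
  qed
  have below: "measure M {x \<in> space M. f x \<le> s} \<le> ?m" if "s < c" for s
  proof -
    have "s \<notin> S" using that cInf_lower[OF _ bdd] unfolding c_def by fastforce
    then have "?m < measure M {x \<in> space M. s < f x}" unfolding S_def by simp
    moreover have "space M - {x \<in> space M. s < f x} = {x \<in> space M. f x \<le> s}" by auto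
    ultimately show ?thesis
      using finite_measure_compl[of "{x \<in> space M. s < f x}"] by simp
  qed
  have lim: "(\<lambda>n. 1 / real (Suc n)) \<longlonglongrightarrow> 0" by (rule LIMSEQ_Suc[OF lim_1_over_n])
  have ex: "\<exists>n. 1 / real (Suc n) < e" if "0 < e" for e
    using order_tendstoD(2)[OF lim that] eventually_happens by force
  have "(\<lambda>n. measure M {x \<in> space M. c + 1 / Suc n < f x}) \<longlonglongrightarrow> measure M (\<Union>n. {x \<in> space M. c + 1 / Suc n < f x})"
  proof (intro finite_Lim_measure_incseq incseq_SucI)
    have "1 / real (Suc (Suc n)) \<le> 1 / real (Suc n)" for n by (simp add: frac_le)
    then show "{x \<in> space M. c + 1 / Suc n < f x} \<subseteq> {x \<in> space M. c + 1 / Suc (Suc n) < f x}" for n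
      by (smt (verit) Collect_mono)
  qed auto
  moreover have "(\<Union>n. {x \<in> space M. c + 1 / Suc n < f x}) = {x \<in> space M. c < f x}"
  proof safe
    fix x assume "x \<in> space M" "c < f x"
    then show "x \<in> (\<Union>n. {x \<in> space M. c + 1 / Suc n < f x})"
      using ex[of "f x - c"] by (auto simp: algebra_simps)
  next
    fix x n assume "c + 1 / real (Suc n) < f x"
    moreover have "0 < 1 / real (Suc n)" by simp
    ultimately show "c < f x" by linarith
  qed
  ultimately have "(\<lambda>n. measure M {x \<in> space M. c + 1 / Suc n < f x}) \<longlonglongrightarrow> measure M {x \<in> space M. c < f x}" by simp
  then have A: "measure M {x \<in> space M. c < f x} \<le> ?m"
    by (rule LIMSEQ_le_const2) (intro exI[of _ 0] allI impI above, simp)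
  have "(\<lambda>n. measure M {x \<in> space M. f x \<le> c - 1 / Suc n}) \<longlonglongrightarrow> measure M (\<Union>n. {x \<in> space M. f x \<le> c - 1 / Suc n})"
  proof (intro finite_Lim_measure_incseq incseq_SucI)
    have "1 / real (Suc (Suc n)) \<le> 1 / real (Suc n)" for n by (simp add: frac_le)
    then show "{x \<in> space M. f x \<le> c - 1 / Suc n} \<subseteq> {x \<in> space M. f x \<le> c - 1 / Suc (Suc n)}" for n
      by (smt (verit) Collect_mono)
  qed auto
  moreover have "(\<Union>n. {x \<in> space M. f x \<le> c - 1 / Suc n}) = {x \<in> space M. f x < c}"
  proof safe
    fix x assume "x \<in> space M" "f x < c"
    then obtain n where "1 / real (Suc n) < c - f x" using ex[of "c - f x"] by auto
    then show "x \<in> (\<Union>n. {x \<in> space M. f x \<le> c - 1 / Suc n})"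
      using \<open>x \<in> space M\<close> by (intro UN_I[of n]) auto
  next
    fix x n assume "f x \<le> c - 1 / real (Suc n)"
    moreover have "0 < 1 / real (Suc n)" by simp
    ultimately show "f x < c" by linarith
  qed
  ultimately have "(\<lambda>n. measure M {x \<in> space M. f x \<le> c - 1 / Suc n}) \<longlonglongrightarrow> measure M {x \<in> space M. f x < c}" by simp
  then have B: "measure M {x \<in> space M. f x < c} \<le> ?m"
    by (rule LIMSEQ_le_const2) (intro exI[of _ 0] allI impI below, simp)
  show ?thesis using A B by blast
qed

section \<open>Estimates on a set with controlled profile quotient, for both signs\<close>

context isoperimetric_hardy_space
begin

text \<open>The function and its negative have the same gradient modulus. Adding the estimates for
  the two positive parts doubles the constant \<open>2 * \<kappa> * B\<close>.\<close>

lemma norm_on_set_le: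
  assumes L: "L-lipschitz_on UNIV f" and b: "\<And>x. \<bar>f x\<bar> \<le> b"
    and m: "0 < m" "ennreal m \<le> emeasure M (space M) / 2"
    and supp: "emeasure M {x. 0 < f x} \<le> ennreal m" "emeasure M {x. f x < 0} \<le> ennreal m"
    and W: "W \<in> sets M" and \<kappa>: "0 \<le> \<kappa>"
    and quot: "\<And>t. 0 < t \<Longrightarrow> t < m \<Longrightarrow> ennreal t < emeasure M W \<Longrightarrow> t / profile M t \<le> \<kappa>"
    and fin: "norm_in \<rho> (gradient_modulus f) < \<infinity>"
  shows "\<rho> (\<lambda>x. ennreal \<bar>f x\<bar> * indicator W x) \<le> ennreal (4 * \<kappa> * B) * norm_in \<rho> (gradient_modulus f)"
proof -
  have b1: "f x \<le> b" "- f x \<le> b" for x using b[of x] by (auto simp: abs_le_iff)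
  interpret pos: positive_part_below_half M \<rho> \<sigma> B f L b m
    by unfold_locales (use L b1 m supp in auto)
  interpret neg: positive_part_below_half M \<rho> \<sigma> B "\<lambda>x. - f x" L b m
    by unfold_locales (use lip_uminus[OF L] b1 m supp in auto)
  have eq: "ennreal \<bar>f x\<bar> * indicator W x = ennreal (f x) * indicator W x + ennreal (- f x) * indicator W x" for x
    by (cases "0 \<le> f x") (auto simp: ennreal_neg)
  have "\<rho> (\<lambda>x. ennreal \<bar>f x\<bar> * indicator W x) \<le> \<rho> (\<lambda>x. ennreal (f x) * indicator W x) + \<rho> (\<lambda>x. ennreal (- f x) * indicator W x)"
    unfolding eq using W by (intro \<rho>_add) auto
  also have "\<dots> \<le> ennreal (2 * \<kappa> * B) * norm_in \<rho> (gradient_modulus f) + ennreal (2 * \<kappa> * B) * norm_in \<rho> (gradient_modulus f)"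
    using pos.norm_positive_part_le[OF W \<kappa> quot fin] neg.norm_positive_part_le[OF W \<kappa> quot] fin
    by (intro add_mono) (auto simp: gradient_modulus_uminus)
  also have "\<dots> = (ennreal (2 * \<kappa> * B) + ennreal (2 * \<kappa> * B)) * norm_in \<rho> (gradient_modulus f)"
    by (rule distrib_right[symmetric])
  also have "ennreal (2 * \<kappa> * B) + ennreal (2 * \<kappa> * B) = ennreal (4 * \<kappa> * B)"
    using \<kappa> B_nonneg by (subst ennreal_plus[symmetric]) auto
  finally show ?thesis .
qed

lemma \<rho>_indicator_finite:
  "E \<in> sets M \<Longrightarrow> emeasure M E < \<infinity> \<Longrightarrow> \<rho> (indicator E) < \<infinity>"
  using ri unfolding ri_norm_def banach_function_norm_def by blast

lemma \<rho>_integral_bound: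
  assumes "E \<in> sets M" "emeasure M E < \<infinity>"
  obtains c where "0 < c" "\<And>f. f \<in> borel_measurable M \<Longrightarrow> (\<integral>\<^sup>+x\<in>E. f x \<partial>M) \<le> ennreal c * \<rho> f"
proof -
  have "\<forall>E\<in>sets M. emeasure M E < \<infinity> \<longrightarrow>
      (\<exists>C>0. \<forall>f\<in>borel_measurable M. (\<integral>\<^sup>+x\<in>E. f x \<partial>M) \<le> ennreal C * \<rho> f)"
    using ri unfolding ri_norm_def banach_function_norm_def by (elim conjE)
  with assms obtain C where "0 < C" "\<forall>f\<in>borel_measurable M. (\<integral>\<^sup>+x\<in>E. f x \<partial>M) \<le> ennreal C * \<rho> f"
    by metis
  then show ?thesis by (intro that[of C]) auto
qed

lemma \<sigma>_indicator_finite: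
  "E \<in> sets (interval_measure_space M) \<Longrightarrow> emeasure (interval_measure_space M) E < \<infinity> \<Longrightarrow> \<sigma> (indicator E) < \<infinity>"
  using ri_\<sigma> unfolding ri_norm_def banach_function_norm_def by blast

text \<open>Applying the Hardy operator to the indicator of \<open>(\<mu>(\<Omega>)/4, \<mu>(\<Omega>)/2)\<close> shows that \<open>I(t)/t\<close> is
  in \<open>X\<close> near \<open>0\<close>, and \<open>1 \<le> K r I(t)/t\<close> on \<open>(0, \<mu>(W))\<close>.\<close>

lemma norm_indicator_weight_le:
  assumes \<mu>: "emeasure M UNIV = ennreal (2 * m)" "0 < m" and K: "0 \<le> K"
  shows "\<exists>c\<ge>0. \<forall>W\<in>sets M. \<forall>r>0.
    (\<forall>t. 0 < t \<longrightarrow> t < m \<longrightarrow> ennreal t < emeasure M W \<longrightarrow> t / profile M t \<le> K * r) \<longrightarrow>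
    \<rho> (indicator W) \<le> ennreal (c * r)"
proof -
  have half: "emeasure M (space M) / 2 = ennreal m"
    using \<mu> divide_ennreal[of "2 * m" 2] by simp
  have hr: "hardy_range M t = {t<..<m}" if "0 \<le> t" for t
    using that unfolding hardy_range_def half by (auto simp: ennreal_less_iff)
  have pos: "0 < profile M t" if "0 < t" "t \<le> m" for t
    using that half_in_profile_dom[of t M] ennreal_leI[of t m] by (intro profile_pos[OF prof]) (auto simp: half[simplified])
  define g :: "real \<Rightarrow> real" where "g = indicator {m / 2<..<m}"
  have g_meas [measurable]: "g \<in> borel_measurable borel" by (simp add: g_def)
  have "emeasure (interval_measure_space M) {m / 2<..<m} = emeasure lborel {m / 2<..<m}"
    using \<mu> by (intro emeasure_interval_measure_space) (auto simp: ennreal_less_iff)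
  moreover have "{m / 2<..<m} \<in> sets (interval_measure_space M)"
    unfolding interval_measure_space_def using \<mu>
    by (subst sets_restrict_space_iff) (auto simp: ennreal_less_iff)
  ultimately have "\<sigma> (indicator {m / 2<..<m}) < \<infinity>"
    using \<mu> by (intro \<sigma>_indicator_finite) auto
  moreover have "norm_in \<sigma> g = \<sigma> (indicator {m / 2<..<m})"
    unfolding norm_in_def g_def by (intro arg_cong[where f=\<sigma>]) (auto simp: indicator_def fun_eq_iff)
  ultimately have g_fin: "norm_in \<sigma> g < \<infinity>" by simp
  note hg = hardy[OF borel_measurable_interval[OF g_meas] g_fin]
  let ?Q = "isoperimetric_hardy M g"
  have Q_meas: "(\<lambda>t. ennreal \<bar>?Q t\<bar>) \<in> borel_measurable (interval_measure_space M)"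
    using borel_measurable_isoperimetric_hardy[OF prof g_meas] by (intro borel_measurable_interval) simp
  have "ennreal B * norm_in \<sigma> g < \<infinity>" using g_fin by (simp add: ennreal_mult_less_top)
  with hg have "norm_in \<sigma> ?Q < top" by (auto intro: le_less_trans)
  then obtain q where q: "norm_in \<sigma> ?Q = ennreal q" "0 \<le> q" by (cases "norm_in \<sigma> ?Q") auto
  \<comment> \<open>A lower bound for the integral of \<open>g / I\<close>: the interval has length
    \<open>m / 2\<close>, and \<open>I(s) \<le> I(m)\<close> on it.\<close>
  define a where "a = (m / 2) / profile M m"
  have a: "0 < a" using \<mu> pos[of m] by (simp add: a_def)
  have Q_ge: "a * (profile M t / t) \<le> ?Q t" if t: "0 < t" "t \<le> m / 2" for t
  proof -
    have "a = (LINT s|lborel. indicator {m / 2<..<m} s *\<^sub>R (1 / profile M m))"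
      using \<mu> by (simp add: a_def)
    also have "\<dots> \<le> (LINT s|lborel. indicator {t<..<m} s *\<^sub>R (g s / profile M s))"
    proof (rule integral_mono)
      show "integrable lborel (\<lambda>s. indicator {m / 2<..<m} s *\<^sub>R (1 / profile M m))"
        using \<mu> by (intro integrable_scaleR_left integrable_real_indicator) auto
      have "t \<in> hardy_range M 0" using t \<mu> hr[of 0] by auto
      then have "set_integrable lborel (hardy_range M t) (\<lambda>s. g s / profile M s)" using hg by blast
      then show "integrable lborel (\<lambda>s. indicator {t<..<m} s *\<^sub>R (g s / profile M s))"
        unfolding set_integrable_def using hr[of t] t by simp
      fix s
      show "indicator {m / 2<..<m} s *\<^sub>R (1 / profile M m) \<le> indicator {t<..<m} s *\<^sub>R (g s / profile M s)"
      proof (cases "s \<in> {m / 2<..<m}")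
        case True
        then have "profile M s \<le> profile M m" "0 < profile M s"
          using t half by (auto intro!: profile_mono_below_half[OF prof] pos)
        then show ?thesis using True t by (simp add: g_def frac_le)
      qed (simp add: g_def)
    qed
    also have "\<dots> = (LINT s:hardy_range M t|lborel. g s / profile M s)"
      unfolding set_lebesgue_integral_def using hr[of t] t by simp
    finally have "profile M t / t * a \<le> profile M t / t * (LINT s:hardy_range M t|lborel. g s / profile M s)"
      using pos[of t] t by (intro mult_left_mono) auto
    then show ?thesis
      unfolding isoperimetric_hardy_def using hr[of 0] t by (simp add: mult.commute)
  qed
  have "\<rho> (indicator UNIV) < \<infinity>"
    using \<mu> by (intro \<rho>_indicator_finite) (auto simp flip: space_M)
  then obtain p where p: "\<rho> (indicator UNIV) = ennreal p" "0 \<le> p" by (cases "\<rho> (indicator UNIV)") auto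
  \<comment> \<open>One summand for each size of \<open>W\<close>. If its measure is at most
    \<open>m / 2\<close>, the Hardy operator applied to \<open>g\<close> dominates the rearranged
    indicator. Otherwise the hypothesis at \<open>t = m / 4\<close> bounds \<open>r\<close> from
    below, and the norm \<open>p\<close> of the constant 1 suffices.\<close>
  define c where "c = K / a * q + p * (K / ((m / 4) / profile M (m / 4)))"
  have pp: "0 < (m / 4) / profile M (m / 4)" using pos[of "m / 4"] \<mu> by simp
  have c1: "0 \<le> K / a * q" "0 \<le> p * (K / ((m / 4) / profile M (m / 4)))"
    using K a q p pp by (auto intro!: mult_nonneg_nonneg divide_nonneg_pos simp del: divide_divide_eq_right divide_divide_eq_left)
  show ?thesis
  proof (intro exI[of _ c] conjI ballI allI impI)
    show "0 \<le> c" using c1 by (simp add: c_def)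
    fix W r
    assume W [measurable]: "W \<in> sets M" and r: "0 < r"
      and *: "\<forall>t. 0 < t \<longrightarrow> t < m \<longrightarrow> ennreal t < emeasure M W \<longrightarrow> t / profile M t \<le> K * r"
    have quot: "t / profile M t \<le> K * r" if "0 < t" "t < m" "ennreal t < emeasure M W" for t
      using * that by blast
    show "\<rho> (indicator W) \<le> ennreal (c * r)"
    proof (cases "emeasure M W \<le> ennreal (m / 2)")
      case True
      have "\<rho> (indicator W) = \<sigma> (rearrangement M (indicator W))"
        by (intro \<rho>_eq_\<sigma>) (auto simp: indicator_def)
      also have "\<dots> \<le> \<sigma> (\<lambda>t. ennreal (K * r / a) * ennreal \<bar>?Q t\<bar>)"
      proof (rule \<sigma>_mono)
        fix t :: real assume t: "0 < t"
        show "rearrangement M (indicator W) t \<le> ennreal (K * r / a) * ennreal \<bar>?Q t\<bar>"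
        proof (cases "ennreal t < emeasure M W")
          case lt: True
          have tm: "t \<le> m / 2"
            using less_le_trans[OF lt True] t by (simp add: ennreal_less_iff)
          have pt: "0 < profile M t" using t tm \<mu> by (intro pos) auto
          have "\<not> 1 < rearrangement M (indicator W) t"
            by (subst less_rearrangement_iff) (auto simp: distribution_fun_def indicator_def)
          then have "rearrangement M (indicator W) t \<le> ennreal 1" by simp
          also have "\<dots> \<le> ennreal (K * r / a * ?Q t)"
          proof (rule ennreal_leI)
            have "t / profile M t \<le> K * r" using t tm \<mu> lt by (intro quot) auto
            then have "1 \<le> K * r * (profile M t / t)" using pt t by (simp add: field_simps)
            also have "\<dots> = K * r / a * (a * (profile M t / t))" using a by simp
            also have "\<dots> \<le> K * r / a * ?Q t"
              using Q_ge[OF t tm] K r a by (intro mult_left_mono) auto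
            finally show "1 \<le> K * r / a * ?Q t" .
          qed
          also have "\<dots> \<le> ennreal (K * r / a) * ennreal \<bar>?Q t\<bar>"
          proof -
            have "K * r / a * ?Q t \<le> K * r / a * \<bar>?Q t\<bar>" using K r a by (intro mult_left_mono) auto
            then show ?thesis using K r a by (subst ennreal_mult[symmetric]) (auto intro: ennreal_leI)
          qed
          finally show ?thesis .
        next
          case False
          have "distribution_fun M (indicator W) 0 = emeasure M W"
            unfolding distribution_fun_def by (intro arg_cong[where f="emeasure M"]) (auto simp: indicator_def split: if_splits)
          then have "\<not> 0 < rearrangement M (indicator W) t"
            using False by (subst less_rearrangement_iff) auto
          then show ?thesis by simp
        qed
      qed (use Q_meas in \<open>auto intro: borel_measurable_interval\<close>)
      also have "\<dots> = ennreal (K * r / a) * norm_in \<sigma> ?Q"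
        unfolding norm_in_def using K r a by (intro \<sigma>_scale Q_meas) simp
      also have "\<dots> = ennreal (K / a * q * r)"
        using K r a q by (simp add: ennreal_mult[symmetric] mult_ac)
      also have "\<dots> \<le> ennreal (c * r)"
        using c1 r unfolding c_def by (intro ennreal_leI mult_right_mono) auto
      finally show ?thesis .
    next
      case False
      let ?t = "m / 4"
      have "ennreal ?t \<le> ennreal (m / 2)" using \<mu> by (intro ennreal_leI) auto
      also have "\<dots> < emeasure M W" using False by simp
      finally have "?t / profile M ?t \<le> K * r" using \<mu> by (intro quot) auto
      then have 1: "1 \<le> K / (?t / profile M ?t) * r"
        using pp by (simp only: times_divide_eq_left le_divide_eq_1_pos)
      have "\<rho> (indicator W) \<le> \<rho> (indicator UNIV)"
        by (intro \<rho>_mono) (auto simp: indicator_def)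
      also have "\<dots> \<le> ennreal (p * (K / (?t / profile M ?t)) * r)"
        unfolding p(1) using mult_left_mono[OF 1 p(2)] by (intro ennreal_leI) (simp only: mult.assoc mult_1_right)
      also have "\<dots> \<le> ennreal (c * r)"
        using c1 r unfolding c_def by (intro ennreal_leI mult_right_mono) auto
      finally show ?thesis .
    qed
  qed
qed

lemma norm_split_by_weight:
  assumes f [measurable]: "f \<in> borel_measurable M" and w [measurable]: "w \<in> borel_measurable M"
    and r: "0 < r" and \<alpha>: "0 < \<alpha>"
  shows "norm_in \<rho> f \<le> \<rho> (\<lambda>x. ennreal \<bar>f x\<bar> * indicator {x \<in> space M. w x \<le> r} x) +
    ennreal (r powr - \<alpha>) * norm_in \<rho> (\<lambda>x. w x powr \<alpha> * f x)"
proof -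
  let ?W = "{x \<in> space M. w x \<le> r}"
  have "norm_in \<rho> f \<le> \<rho> (\<lambda>x. ennreal \<bar>f x\<bar> * indicator ?W x + ennreal (r powr - \<alpha>) * ennreal \<bar>w x powr \<alpha> * f x\<bar>)"
    unfolding norm_in_def
  proof (rule \<rho>_mono)
    fix x
    show "ennreal \<bar>f x\<bar> \<le> ennreal \<bar>f x\<bar> * indicator ?W x + ennreal (r powr - \<alpha>) * ennreal \<bar>w x powr \<alpha> * f x\<bar>"
    proof (cases "w x \<le> r")
      case False
      have "1 = r powr - \<alpha> * r powr \<alpha>" using r by (simp flip: powr_add)
      also have "\<dots> \<le> r powr - \<alpha> * w x powr \<alpha>"
        using False r \<alpha> by (intro mult_left_mono powr_mono2) auto
      finally have "1 * \<bar>f x\<bar> \<le> r powr - \<alpha> * w x powr \<alpha> * \<bar>f x\<bar>"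
        by (intro mult_right_mono) auto
      then have "ennreal \<bar>f x\<bar> \<le> ennreal (r powr - \<alpha>) * ennreal \<bar>w x powr \<alpha> * f x\<bar>"
        by (subst ennreal_mult[symmetric]) (auto intro!: ennreal_leI simp: abs_mult mult.assoc)
      then show ?thesis using False by simp
    qed simp
  qed auto
  also have "\<dots> \<le> \<rho> (\<lambda>x. ennreal \<bar>f x\<bar> * indicator ?W x) + \<rho> (\<lambda>x. ennreal (r powr - \<alpha>) * ennreal \<bar>w x powr \<alpha> * f x\<bar>)"
    by (intro \<rho>_add) auto
  also have "\<rho> (\<lambda>x. ennreal (r powr - \<alpha>) * ennreal \<bar>w x powr \<alpha> * f x\<bar>) = ennreal (r powr - \<alpha>) * norm_in \<rho> (\<lambda>x. w x powr \<alpha> * f x)"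
    unfolding norm_in_def by (intro \<rho>_scale[where f="\<lambda>x. ennreal \<bar>w x powr \<alpha> * f x\<bar>" and g="\<lambda>x. 0"]) auto
  finally show ?thesis .
qed

lemma borel_measurable_lip: "f \<in> lip \<Longrightarrow> f \<in> borel_measurable M"
  unfolding lip_def using lipschitz_on_continuous_on
  by (blast intro: borel_measurable_M borel_measurable_continuous_onI)

text \<open>A Lipschitz function with compact support is bounded and its support has finite measure,
  while half of the total mass is infinite, so any \<open>m\<close> above the measure of the support
  is admissible.\<close>

lemma restricted_norm_le_infinite:
  assumes inf: "emeasure M UNIV = top"
    and f: "f \<in> lip0"
    and W: "W \<in> sets M" and \<kappa>: "0 \<le> \<kappa>"
    and quot: "\<And>t. 0 < t \<Longrightarrow> ennreal t < emeasure M W \<Longrightarrow> t / profile M t \<le> \<kappa>"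
    and fin: "norm_in \<rho> (gradient_modulus f) < \<infinity>"
    and K: "\<And>K. compact K \<Longrightarrow> emeasure M K < \<infinity>"
  shows "\<rho> (\<lambda>x. ennreal \<bar>f x\<bar> * indicator W x) \<le> ennreal (4 * \<kappa> * B) * norm_in \<rho> (gradient_modulus f)"
proof -
  obtain L where L: "L-lipschitz_on UNIV f" using f unfolding lip0_def lip_def by auto
  define K where "K = closure {x. f x \<noteq> 0}"
  have cK: "compact K" using f unfolding lip0_def K_def by auto
  have "compact (f ` K)"
    using cK lipschitz_on_continuous_on[OF L] continuous_on_subset by (blast intro: compact_continuous_image)
  then obtain b where b: "\<And>x. x \<in> K \<Longrightarrow> \<bar>f x\<bar> \<le> b"
    using compact_imp_bounded bounded_iff[of "f ` K"] by auto
  \<comment> \<open>The bound \<open>b\<close> is tested only on \<open>K\<close>, which may be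
    empty; its absolute value is also valid where \<open>f\<close> vanishes.\<close>
  have b': "\<bar>f x\<bar> \<le> \<bar>b\<bar>" for x
  proof (cases "f x = 0")
    case False
    then have "x \<in> K" unfolding K_def using closure_subset[of "{x. f x \<noteq> 0}"] by auto
    then show ?thesis using b[of x] by linarith
  qed simp
  \<comment> \<open>Adding 1 keeps \<open>m\<close> positive when the support is a null set.\<close>
  define m where "m = measure M K + 1"
  have m0: "0 < m" unfolding m_def by (simp add: add_nonneg_pos)
  have KM: "K \<in> sets M" unfolding K_def sets_M by (intro borel_closed) simp
  have "emeasure M K = ennreal (measure M K)"
    using assms(7)[OF cK] by (intro emeasure_eq_ennreal_measure) auto
  also have "\<dots> \<le> ennreal m" unfolding m_def by (intro ennreal_leI) simp
  finally have Km: "emeasure M K \<le> ennreal m" .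
  have sub: "emeasure M A \<le> ennreal m" if "A \<subseteq> {x. f x \<noteq> 0}" for A
  proof -
    have "emeasure M A \<le> emeasure M K"
      using that closure_subset KM unfolding K_def by (intro emeasure_mono) auto
    then show ?thesis using Km by (rule order_trans)
  qed
  show ?thesis
  proof (rule norm_on_set_le[OF L b' m0 _ _ _ W \<kappa> _ fin])
    show "ennreal m \<le> emeasure M (space M) / 2" using inf by (simp add: ennreal_top_divide)
    show "emeasure M {x. 0 < f x} \<le> ennreal m" "emeasure M {x. f x < 0} \<le> ennreal m" by (auto intro!: sub)
  qed (use quot in auto)
qed

text \<open>The constant is chosen before \<open>f\<close>, \<open>W\<close> and \<open>r\<close>.
  If 0 is a median, \<open>norm_on_set_le\<close> applies to \<open>f\<close>; if the mean is 0, it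
  applies to \<open>f - c\<close> for a median \<open>c\<close>, and the norm of \<open>c\<close> on
  \<open>W\<close> has to be added.\<close>

lemma restricted_norm_le_finite:
  assumes \<mu>: "emeasure M UNIV = ennreal (2 * m)" "0 < m" and K: "0 \<le> K"
  shows "\<exists>C\<ge>0. \<forall>f W r. f \<in> lip \<longrightarrow> bounded (range f) \<longrightarrow> is_median M f 0 \<or> (\<integral>x. f x \<partial>M) = 0 \<longrightarrow>
      W \<in> sets M \<longrightarrow> 0 < r \<longrightarrow>
      (\<forall>t. 0 < t \<longrightarrow> t < m \<longrightarrow> ennreal t < emeasure M W \<longrightarrow> t / profile M t \<le> K * r) \<longrightarrow>
      norm_in \<rho> (gradient_modulus f) < \<infinity> \<longrightarrow>
      \<rho> (\<lambda>x. ennreal \<bar>f x\<bar> * indicator W x) \<le> ennreal (r * C) * norm_in \<rho> (gradient_modulus f)"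
proof -
  interpret fm: finite_measure M by (rule finite_measureI) (simp add: \<mu>)
  have meas: "measure M UNIV = 2 * m" using \<mu> by (simp add: measure_def)
  have half: "emeasure M (space M) / 2 = ennreal m"
    using \<mu> divide_ennreal[of "2 * m" 2] by simp
  obtain c1 where c1: "0 \<le> c1" "\<forall>W\<in>sets M. \<forall>r>0.
      (\<forall>t. 0 < t \<longrightarrow> t < m \<longrightarrow> ennreal t < emeasure M W \<longrightarrow> t / profile M t \<le> K * r) \<longrightarrow>
      \<rho> (indicator W) \<le> ennreal (c1 * r)"
    using norm_indicator_weight_le[OF \<mu> K] by blast
  obtain c2 where c2: "0 < c2" "\<And>f. f \<in> borel_measurable M \<Longrightarrow> (\<integral>\<^sup>+x\<in>UNIV. f x \<partial>M) \<le> ennreal c2 * \<rho> f"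
    using \<rho>_integral_bound[of UNIV] \<mu> sets.top[of M] by auto
  have mdom: "m \<in> profile_dom M" using \<mu> half by (intro half_in_profile_dom) auto
  \<comment> \<open>The quotient at half the mass bounds all earlier ones, so it serves for the
    choice of the whole space as \<open>W\<close>.\<close>
  define \<kappa>0 where "\<kappa>0 = m / profile M m"
  have \<kappa>0: "0 \<le> \<kappa>0" using profile_pos[OF prof mdom] \<mu> by (simp add: \<kappa>0_def)
  \<comment> \<open>Collects the constants in the bound of \<open>|c|\<close> by \<open>D\<close>
    times the gradient norm; \<open>c2\<close> compares the integral with the norm, and
    \<open>2 * m\<close> is the total mass.\<close>
  define D where "D = c2 * (4 * \<kappa>0 * B) / (2 * m)"
  have D: "0 \<le> D" using c2 \<kappa>0 B_nonneg \<mu> by (simp add: D_def)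
  show ?thesis
  proof (intro exI[of _ "4 * K * B + D * c1"] conjI allI impI)
    show "0 \<le> 4 * K * B + D * c1" using K B_nonneg D c1 by simp
    fix f :: "'a \<Rightarrow> real" and W :: "'a set" and r :: real
    assume f: "f \<in> lip" "bounded (range f)" "is_median M f 0 \<or> (\<integral>x. f x \<partial>M) = 0"
      and W: "W \<in> sets M" and r: "0 < r"
      and *: "\<forall>t. 0 < t \<longrightarrow> t < m \<longrightarrow> ennreal t < emeasure M W \<longrightarrow> t / profile M t \<le> K * r"
      and fin: "norm_in \<rho> (gradient_modulus f) < \<infinity>"
    have quot: "t / profile M t \<le> K * r" if "0 < t" "t < m" "ennreal t < emeasure M W" for t
      using * that by blast
    have W_le: "\<rho> (indicator W) \<le> ennreal (c1 * r)"
      using c1(2) W r * by blast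
    let ?G = "norm_in \<rho> (gradient_modulus f)"
    note [measurable] = W
    obtain L where L: "L-lipschitz_on UNIV f" using f unfolding lip_def by auto
    obtain b where b: "\<And>x. \<bar>f x\<bar> \<le> b" using f(2) unfolding bounded_iff by auto
    have fM [measurable]: "f \<in> borel_measurable M" using f(1) by (rule borel_measurable_lip)
    have sets1 [measurable]: "{x. c < f x} \<in> sets M" "{x. f x < c} \<in> sets M" "{x. c \<le> f x} \<in> sets M" "{x. f x \<le> c} \<in> sets M" for c
      by (rule Collect_in_sets_M, measurable)+
    have Kr: "0 \<le> K * r" using K r by simp
    have shifted: "\<rho> (\<lambda>x. ennreal \<bar>f x - c\<bar> * indicator V x) \<le> ennreal (4 * \<kappa> * B) * ?G"
      if c: "measure M {x. c < f x} \<le> m" "measure M {x. f x < c} \<le> m"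
        and V: "V \<in> sets M" "0 \<le> \<kappa>" "\<And>t. 0 < t \<Longrightarrow> t < m \<Longrightarrow> ennreal t < emeasure M V \<Longrightarrow> t / profile M t \<le> \<kappa>"
      for c V \<kappa>
    proof -
      have "\<rho> (\<lambda>x. ennreal \<bar>f x - c\<bar> * indicator V x) \<le> ennreal (4 * \<kappa> * B) * norm_in \<rho> (gradient_modulus (\<lambda>x. f x - c))"
      proof (rule norm_on_set_le[OF lip_diff_const[OF L] _ \<mu>(2) _ _ _ V])
        show "\<bar>f x - c\<bar> \<le> b + \<bar>c\<bar>" for x using b[of x] by linarith
        show "ennreal m \<le> emeasure M (space M) / 2" using half by simp
        show "emeasure M {x. 0 < f x - c} \<le> ennreal m" "emeasure M {x. f x - c < 0} \<le> ennreal m"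
          using c by (simp_all add: fm.emeasure_eq_measure ennreal_leI)
        show "norm_in \<rho> (gradient_modulus (\<lambda>x. f x - c)) < \<infinity>" using fin by (simp add: gradient_modulus_diff_const)
      qed
      then show ?thesis by (simp add: gradient_modulus_diff_const)
    qed
    have "\<rho> (\<lambda>x. ennreal \<bar>f x\<bar> * indicator W x) \<le> ennreal (4 * (K * r) * B + D * c1 * r) * ?G"
      using f(3)
    proof
      assume "is_median M f 0"
      then have "ennreal m \<le> emeasure M {x. 0 \<le> f x}" "ennreal m \<le> emeasure M {x. f x \<le> 0}"
        using half unfolding is_median_def by auto
      then have ge: "m \<le> measure M {x. 0 \<le> f x}" "m \<le> measure M {x. f x \<le> 0}"
        by (simp_all add: fm.emeasure_eq_measure)
      have "UNIV - {x. 0 \<le> f x} = {x. f x < 0}" "UNIV - {x. f x \<le> 0} = {x. 0 < f x}" by auto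
      then have "measure M {x. f x < 0} \<le> m" "measure M {x. 0 < f x} \<le> m"
        using fm.finite_measure_compl[OF sets1(3)[of 0]] fm.finite_measure_compl[OF sets1(4)[of 0]] ge meas by auto
      then have "\<rho> (\<lambda>x. ennreal \<bar>f x\<bar> * indicator W x) \<le> ennreal (4 * (K * r) * B) * ?G"
        using shifted[of 0 W "K * r"] W Kr quot by simp
      also have "\<dots> \<le> ennreal (4 * (K * r) * B + D * c1 * r) * ?G"
        using D c1 r by (intro mult_right_mono ennreal_leI) auto
      finally show ?thesis .
    next
      assume mean: "(\<integral>x. f x \<partial>M) = 0"
      obtain c where c: "measure M {x. c < f x} \<le> m" "measure M {x. f x < c} \<le> m"
        using fm.ex_median[of f b] b meas \<mu>(2) by auto
      have int: "integrable M f" by (rule fm.integrable_const_bound[of _ b]) (use b in auto)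
      \<comment> \<open>As \<open>f\<close> has mean 0, the integral of \<open>f - c\<close> is
        \<open>-c\<close> times the total mass.\<close>
      have "ennreal (\<bar>c\<bar> * (2 * m)) = ennreal \<bar>\<integral>x. f x - c \<partial>M\<bar>"
        using int mean meas \<mu>(2) by (simp add: abs_mult)
      also have "\<dots> \<le> ennreal (\<integral>x. \<bar>f x - c\<bar> \<partial>M)"
        by (intro ennreal_leI integral_abs_bound)
      also have "\<dots> = (\<integral>\<^sup>+x. ennreal \<bar>f x - c\<bar> \<partial>M)"
        using int by (intro nn_integral_eq_integral[symmetric]) auto
      also have "\<dots> \<le> ennreal c2 * \<rho> (\<lambda>x. ennreal \<bar>f x - c\<bar>)"
        using c2(2)[of "\<lambda>x. ennreal \<bar>f x - c\<bar>"] by simp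
      also have "\<dots> \<le> ennreal c2 * (ennreal (4 * \<kappa>0 * B) * ?G)"
      proof (rule mult_left_mono)
        have "t / profile M t \<le> \<kappa>0" if "0 < t" "t < m" for t
          unfolding \<kappa>0_def using that by (intro profile_quotient_mono[OF prof mdom]) auto
        then show "\<rho> (\<lambda>x. ennreal \<bar>f x - c\<bar>) \<le> ennreal (4 * \<kappa>0 * B) * ?G"
          using shifted[OF c, of UNIV \<kappa>0] \<kappa>0 sets.top[of M] by simp
      qed simp
      finally have "ennreal (1 / (2 * m)) * ennreal (\<bar>c\<bar> * (2 * m)) \<le> ennreal (1 / (2 * m)) * (ennreal c2 * (ennreal (4 * \<kappa>0 * B) * ?G))"
        by (rule mult_left_mono) simp
      also have "ennreal (1 / (2 * m)) * ennreal (\<bar>c\<bar> * (2 * m)) = ennreal \<bar>c\<bar>"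
        using \<mu>(2) by (simp flip: ennreal_mult)
      also have "ennreal (1 / (2 * m)) * (ennreal c2 * (ennreal (4 * \<kappa>0 * B) * ?G)) = ennreal D * ?G"
        using c2 \<kappa>0 B_nonneg \<mu>(2) by (simp add: D_def mult.assoc[symmetric] flip: ennreal_mult) (simp add: mult_ac)
      finally have c_le: "ennreal \<bar>c\<bar> \<le> ennreal D * ?G" .
      have "\<rho> (\<lambda>x. ennreal \<bar>f x\<bar> * indicator W x) \<le> \<rho> (\<lambda>x. ennreal \<bar>f x - c\<bar> * indicator W x + ennreal \<bar>c\<bar> * indicator W x)"
      proof (rule \<rho>_mono)
        fix x
        have "ennreal \<bar>f x\<bar> \<le> ennreal (\<bar>f x - c\<bar> + \<bar>c\<bar>)"
          by (intro ennreal_leI) linarith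
        also have "\<dots> = ennreal \<bar>f x - c\<bar> + ennreal \<bar>c\<bar>"
          by (rule ennreal_plus) auto
        finally have "ennreal \<bar>f x\<bar> \<le> ennreal \<bar>f x - c\<bar> + ennreal \<bar>c\<bar>" .
        then show "ennreal \<bar>f x\<bar> * indicator W x \<le> ennreal \<bar>f x - c\<bar> * indicator W x + ennreal \<bar>c\<bar> * indicator W x"
          by (simp add: indicator_def)
      qed auto
      also have "\<dots> \<le> \<rho> (\<lambda>x. ennreal \<bar>f x - c\<bar> * indicator W x) + \<rho> (\<lambda>x. ennreal \<bar>c\<bar> * indicator W x)"
        by (intro \<rho>_add) auto
      also have "\<rho> (\<lambda>x. ennreal \<bar>c\<bar> * indicator W x) = ennreal \<bar>c\<bar> * \<rho> (indicator W)"
        by (intro \<rho>_scale[where g="\<lambda>x. 0"]) auto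
      also have "\<rho> (\<lambda>x. ennreal \<bar>f x - c\<bar> * indicator W x) + ennreal \<bar>c\<bar> * \<rho> (indicator W) \<le>
          ennreal (4 * (K * r) * B) * ?G + ennreal D * ?G * ennreal (c1 * r)"
        using W_le shifted[OF c W Kr quot] c_le by (intro add_mono mult_mono) auto
      also have "\<dots> = (ennreal (4 * (K * r) * B) + ennreal (D * (c1 * r))) * ?G"
        using D c1(1) r by (simp add: distrib_left ennreal_mult mult_ac)
      also have "ennreal (4 * (K * r) * B) + ennreal (D * (c1 * r)) = ennreal (4 * (K * r) * B + D * c1 * r)"
        using D c1(1) r K B_nonneg by (subst ennreal_plus[symmetric]) (auto simp: mult.assoc)
      finally show ?thesis .
    qed
    also have "4 * (K * r) * B + D * c1 * r = r * (4 * K * B + D * c1)" by (simp add: algebra_simps)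
    finally show "\<rho> (\<lambda>x. ennreal \<bar>f x\<bar> * indicator W x) \<le> ennreal (r * (4 * K * B + D * c1)) * ?G" .
  qed
qed

end

section \<open>The weighted inequality with a constant independent of the exponent\<close>

theorem theorem12:
  fixes M :: "'a::metric_space measure"
    and \<rho> :: "('a \<Rightarrow> ennreal) \<Rightarrow> ennreal"
    and \<sigma> :: "(real \<Rightarrow> ennreal) \<Rightarrow> ennreal"
    and w :: "'a \<Rightarrow> real"
  assumes "metric_measure_space M"
    and "profile_conditions M"
    and "resonant M"
    and "ri_norm M \<rho>"
    and "represents M \<rho> \<sigma>"
    and "isoperimetric_hardy_bounded M \<sigma>"
    and "isoperimetric_weight M w"
  shows "\<exists>C>0. \<forall>\<alpha>>0. \<forall>f.
    (if emeasure M (space M) < \<infinity>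
     then f \<in> lip \<and> bounded (range f) \<and> (is_median M f 0 \<or> (\<integral>x. f x \<partial>M) = 0)
     else f \<in> lip0) \<longrightarrow>
    (\<forall>r>0. norm_in \<rho> f \<le>
       ennreal (r * C) * norm_in \<rho> (gradient_modulus f) +
       ennreal (r powr (- \<alpha>)) * norm_in \<rho> (\<lambda>x. w x powr \<alpha> * f x))"
proof -
  obtain B where "0 \<le> B" and B: "\<forall>h\<in>borel_measurable (interval_measure_space M). norm_in \<sigma> h < \<infinity> \<longrightarrow>
        (\<forall>t\<in>hardy_range M 0. set_integrable lborel (hardy_range M t) (\<lambda>s. h s / profile M s)) \<and>
        norm_in \<sigma> (isoperimetric_hardy M h) \<le> ennreal B * norm_in \<sigma> h"
    using assms(6) unfolding isoperimetric_hardy_bounded_def by metis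
  interpret isoperimetric_hardy_space M \<rho> \<sigma> B
    by unfold_locales (use assms(1,2,4,5) \<open>0 \<le> B\<close> B in \<open>auto simp: metric_measure_space_def\<close>)
  have w [measurable]: "w \<in> borel_measurable M" using assms(7) unfolding isoperimetric_weight_def by simp
  let ?W = "\<lambda>r. {x \<in> space M. w x \<le> r}"
  obtain K where K: "0 < K" "\<And>r. 0 < r \<Longrightarrow>
      profile_quotient M (min (emeasure M (?W r)) (emeasure M (space M) / 2)) \<le> ennreal (K * r)"
    using assms(7) unfolding isoperimetric_weight_def by metis
  have quot: "t / profile M t \<le> K * r"
    if "0 < r" "0 < t" "ennreal t \<le> emeasure M (?W r)" "ennreal t \<le> emeasure M (space M) / 2" for t r
    using that K by (intro profile_quotient_bound[OF prof K(2)]) auto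
  \<comment> \<open>The constant is fixed before \<alpha>, which enters only through the splitting
    at the end. Functions with infinite gradient norm are set aside until then.\<close>
  have "\<exists>C\<ge>0. \<forall>f. (if emeasure M (space M) < \<infinity>
     then f \<in> lip \<and> bounded (range f) \<and> (is_median M f 0 \<or> (\<integral>x. f x \<partial>M) = 0)
     else f \<in> lip0) \<longrightarrow> norm_in \<rho> (gradient_modulus f) < \<infinity> \<longrightarrow> (\<forall>r>0.
       \<rho> (\<lambda>x. ennreal \<bar>f x\<bar> * indicator (?W r) x) \<le> ennreal (r * C) * norm_in \<rho> (gradient_modulus f))"
  proof (cases "emeasure M (space M)")
    case top
    have "\<rho> (\<lambda>x. ennreal \<bar>f x\<bar> * indicator (?W r) x) \<le> ennreal (r * (4 * K * B)) * norm_in \<rho> (gradient_modulus f)"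
      if "f \<in> lip0" "norm_in \<rho> (gradient_modulus f) < \<infinity>" "0 < r" for f r
    proof -
      have "\<rho> (\<lambda>x. ennreal \<bar>f x\<bar> * indicator (?W r) x) \<le> ennreal (4 * (K * r) * B) * norm_in \<rho> (gradient_modulus f)"
      proof (rule restricted_norm_le_infinite)
        show "t / profile M t \<le> K * r" if "0 < t" "ennreal t < emeasure M (?W r)" for t
          using that \<open>0 < r\<close> top by (intro quot) (auto simp: ennreal_top_divide)
        show "emeasure M K < \<infinity>" if "compact K" for K
          using that assms(1) unfolding metric_measure_space_def by blast
      qed (use top that K in auto)
      then show ?thesis by (simp add: mult_ac)
    qed
    then show ?thesis using K \<open>0 \<le> B\<close> top by (intro exI[of _ "4 * K * B"]) auto
  next
    case (real x)
    show ?thesis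
    \<comment> \<open>For zero total mass there is no positive \<open>m\<close> at most half of it,
      but then every function vanishes almost everywhere and the left-hand side is 0.\<close>
    proof (cases "x = 0")
      case True
      then have "AE x in M. P x" for P
        using real by (intro AE_I[of _ _ "space M"]) auto
      then have "\<rho> (\<lambda>x. ennreal \<bar>f x\<bar> * indicator (?W r) x) = 0" if "f \<in> lip" for f r
        using borel_measurable_lip[OF that] by (intro \<rho>_zero[where g="\<lambda>x. 0"]) auto
      then show ?thesis using real by (intro exI[of _ 0]) auto
    next
      case False
      then have \<mu>: "emeasure M UNIV = ennreal (2 * (x / 2))" "0 < x / 2" using real by auto
      obtain C where C: "0 \<le> C" "\<forall>f W r. f \<in> lip \<longrightarrow> bounded (range f) \<longrightarrow> is_median M f 0 \<or> (\<integral>x. f x \<partial>M) = 0 \<longrightarrow>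
          W \<in> sets M \<longrightarrow> 0 < r \<longrightarrow>
          (\<forall>t. 0 < t \<longrightarrow> t < x / 2 \<longrightarrow> ennreal t < emeasure M W \<longrightarrow> t / profile M t \<le> K * r) \<longrightarrow>
          norm_in \<rho> (gradient_modulus f) < \<infinity> \<longrightarrow>
          \<rho> (\<lambda>x. ennreal \<bar>f x\<bar> * indicator W x) \<le> ennreal (r * C) * norm_in \<rho> (gradient_modulus f)"
        using restricted_norm_le_finite[OF \<mu> less_imp_le[OF K(1)]] by blast
      have "emeasure M (space M) / 2 = ennreal (x / 2)"
        using \<mu> divide_ennreal[of x 2] by simp
      then have "t / profile M t \<le> K * r" if "0 < r" "0 < t" "t < x / 2" "ennreal t < emeasure M (?W r)" for t r
        using that by (intro quot) (auto intro: ennreal_leI)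
      then show ?thesis using C real by (intro exI[of _ C]) auto
    qed
  qed
  then obtain C where C: "0 \<le> C" "\<And>f r. (if emeasure M (space M) < \<infinity>
     then f \<in> lip \<and> bounded (range f) \<and> (is_median M f 0 \<or> (\<integral>x. f x \<partial>M) = 0)
     else f \<in> lip0) \<Longrightarrow> norm_in \<rho> (gradient_modulus f) < \<infinity> \<Longrightarrow> 0 < r \<Longrightarrow>
       \<rho> (\<lambda>x. ennreal \<bar>f x\<bar> * indicator (?W r) x) \<le> ennreal (r * C) * norm_in \<rho> (gradient_modulus f)"
    by blast
  show ?thesis
  \<comment> \<open>Adding 1 makes the constant positive, so that an infinite gradient norm makes
    the right-hand side infinite even if \<open>C = 0\<close>.\<close>
  proof (intro exI[of _ "C + 1"] conjI allI impI)
    show "0 < C + 1" using C(1) by simp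
    fix \<alpha> f r
    assume \<alpha>: "0 < (\<alpha> :: real)" and r: "0 < (r :: real)"
      and f: "if emeasure M (space M) < \<infinity>
        then f \<in> lip \<and> bounded (range f) \<and> (is_median M f 0 \<or> (\<integral>x. f x \<partial>M) = 0)
        else f \<in> lip0"
    let ?G = "norm_in \<rho> (gradient_modulus f)"
    have "f \<in> lip" using f by (auto simp: lip0_def split: if_splits)
    then have fM: "f \<in> borel_measurable M" by (rule borel_measurable_lip)
    show "norm_in \<rho> f \<le> ennreal (r * (C + 1)) * ?G + ennreal (r powr - \<alpha>) * norm_in \<rho> (\<lambda>x. w x powr \<alpha> * f x)"
    proof (cases "?G < \<infinity>")
      case False
      then have "?G = top" by (simp add: less_top[symmetric])
      then have "ennreal (r * (C + 1)) * ?G = top"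
        using r C(1) by (simp add: ennreal_mult_top)
      then show ?thesis by simp
    next
      case True
      have "norm_in \<rho> f \<le> \<rho> (\<lambda>x. ennreal \<bar>f x\<bar> * indicator (?W r) x) +
          ennreal (r powr - \<alpha>) * norm_in \<rho> (\<lambda>x. w x powr \<alpha> * f x)"
        by (rule norm_split_by_weight[OF fM w r \<alpha>])
      also have "\<rho> (\<lambda>x. ennreal \<bar>f x\<bar> * indicator (?W r) x) \<le> ennreal (r * C) * ?G"
        using f True r by (rule C(2))
      also have "ennreal (r * C) * ?G \<le> ennreal (r * (C + 1)) * ?G"
        using r by (intro mult_right_mono ennreal_leI) auto
      finally show ?thesis by (simp add: add_right_mono)
    qed
  qed
qed

end
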